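(* Let $k\geqslant p\geqslant 1$ and let $\tau\in\mathfrak S_k$ be an arbitrary $p$-layered pattern. Let $T=\{(1,2,3),\tau\}$ and $F_T(x)=\sum_{n\geqslant 0}|\mathfrak S_n(T)|x^n$. Then: (i) if $p=1$, then $F_T(x)$ is a polynomial of degree $2k-2$; (ii) if $p=2$, then $$F_T(x)=R_k(x):=\frac{U_{k-1}\left(\frac1{2\sqrt{x}}\right)}{\sqrt{x}\,U_{k}\left(\frac1{2\sqrt{x}}\right)},$$ where $U_r$ is the Chebyshev polynomial of the second kind, $U_r(\cos\theta)=\sin((r+1)\theta)/\sin\theta$; (iii) if $p\geqslant 3$, then $F_T(x)=\dfrac{1-\sqrt{1-4x}}{2x}$.
   Context: For permutations $\pi\in\mathfrak S_n$ and $\tau\in\mathfrak S_k$, an occurrence of $\tau$ in $\pi$ is a subsequence $1\leqslant i_1<\dots<i_k\leqslant n$ such that $(\pi_{i_1},\dots,\pi_{i_k})$ is order-isomorphic to $\tau$; $\pi$ avoids $\tau$ if there is no occurrence of $\tau$ in $\pi$. For a finite set of patterns $T$, $\mathfrak S_n(T)$ denotes the set of permutations in $\mathfrak S_n$ avoiding every pattern in $T$ (with $|\mathfrak S_0(T)|=1$). A permutation $\tau\in\mathfrak S_k$ is $p$-layered if it is the concatenation of $p$ nonempty consecutive substrings (layers) such that the entries decrease within each layer and every entry of a layer is smaller than every entry of any later layer; for $k_1,\dots,k_p\geqslant1$, $w(k_1,\dots,k_p)$ denotes the unique layered pattern of length $k_1+\dots+k_p$ whose $i$th layer has length $k_i$.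 *)

theory Defs
  imports
    Complex_Main
    "HOL-Combinatorics.Multiset_Permutations"
    "HOL-Computational_Algebra.Polynomial_FPS"
    "HOL-Computational_Algebra.Formal_Laurent_Series"
begin

text \<open>Permutations of \<open>{1..n}\<close> are lists in one-line notation, i.e. elements of
  \<^term>\<open>permutations_of_set {1..n}\<close>. Positions in lists are counted from 0.\<close>

definition order_isomorphic :: "nat list \<Rightarrow> nat list \<Rightarrow> bool" where
  "order_isomorphic xs ys \<longleftrightarrow> length xs = length ys \<and>
     (\<forall>a<length xs. \<forall>b<length xs. xs ! a < xs ! b \<longleftrightarrow> ys ! a < ys ! b)"

definition is_occurrence :: "nat list \<Rightarrow> nat list \<Rightarrow> nat list \<Rightarrow> bool" where
  "is_occurrence \<tau> \<pi> idx \<longleftrightarrow> sorted_wrt (<) idx \<and> set idx \<subseteq> {..<length \<pi>} \<and>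
     order_isomorphic (map (\<lambda>i. \<pi> ! i) idx) \<tau>"

definition avoids :: "nat list \<Rightarrow> nat list \<Rightarrow> bool" where
  "avoids \<pi> \<tau> \<longleftrightarrow> \<not> (\<exists>idx. is_occurrence \<tau> \<pi> idx)"

definition avoiders :: "nat \<Rightarrow> nat list set \<Rightarrow> nat list set" where
  "avoiders n T = {\<pi> \<in> permutations_of_set {1..n}. \<forall>\<tau>\<in>T. avoids \<pi> \<tau>}"

definition avoiders_gf :: "nat list set \<Rightarrow> real fps" where
  "avoiders_gf T = Abs_fps (\<lambda>n. of_nat (card (avoiders n T)))"

definition layered :: "nat \<Rightarrow> nat list \<Rightarrow> bool" where
  "layered p \<tau> \<longleftrightarrow> (\<exists>Ls. length Ls = p \<and> [] \<notin> set Ls \<and> \<tau> = concat Ls \<and>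
     (\<forall>L\<in>set Ls. sorted_wrt (>) L) \<and>
     sorted_wrt (\<lambda>L M. \<forall>x\<in>set L. \<forall>y\<in>set M. x < y) Ls)"

definition chebyshev_U :: "nat \<Rightarrow> real poly" where
  "chebyshev_U r = (THE q. \<forall>\<theta>. sin \<theta> \<noteq> 0 \<longrightarrow> poly q (cos \<theta>) = sin ((real r + 1) * \<theta>) / sin \<theta>)"

lemma chebyshev_U_unique:
  fixes q q' :: "real poly"
  assumes "\<And>\<theta>. sin \<theta> \<noteq> 0 \<Longrightarrow> poly q (cos \<theta>) = f \<theta>"
    and "\<And>\<theta>. sin \<theta> \<noteq> 0 \<Longrightarrow> poly q' (cos \<theta>) = f \<theta>"
  shows "q = q'"
proof (rule ccontr)
  assume "q \<noteq> q'"
  then have "finite {x. poly (q - q') x = 0}"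
    by (intro poly_roots_finite) simp
  moreover have "{-1<..<1} \<subseteq> {x. poly (q - q') x = 0}"
  proof
    fix x :: real
    assume x: "x \<in> {-1<..<1}"
    then have "cos (arccos x) = x" by simp
    moreover have "sin (arccos x) \<noteq> 0"
      using x by (intro sin_arccos_nonzero) auto
    ultimately show "x \<in> {x. poly (q - q') x = 0}"
      using assms[of "arccos x"] by simp
  qed
  ultimately have "finite {-1<..<1::real}"
    by (rule finite_subset[rotated])
  then show False
    using infinite_Ioo[of "-1" "1 :: real"] by simp
qed

lemma chebyshev_U_exists:
  "\<exists>q q' :: real poly. \<forall>\<theta>. sin \<theta> \<noteq> 0 \<longrightarrow>
     poly q (cos \<theta>) = sin ((real r + 1) * \<theta>) / sin \<theta> \<and>
     poly q' (cos \<theta>) = sin ((real r + 2) * \<theta>) / sin \<theta>"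
proof (induction r)
  case 0
  show ?case
    by (rule exI[of _ 1], rule exI[of _ "[:0, 2:]"]) (auto simp: sin_double)
next
  case (Suc r)
  then obtain q q' :: "real poly" where q: "\<And>\<theta>. sin \<theta> \<noteq> 0 \<Longrightarrow>
     poly q (cos \<theta>) = sin ((real r + 1) * \<theta>) / sin \<theta> \<and>
     poly q' (cos \<theta>) = sin ((real r + 2) * \<theta>) / sin \<theta>" by blast
  have s: "sin ((real r + 3) * \<theta>) = 2 * cos \<theta> * sin ((real r + 2) * \<theta>) - sin ((real r + 1) * \<theta>)"
    for \<theta>
  proof -
    have "(real r + 3) * \<theta> = (real r + 2) * \<theta> + \<theta>" "(real r + 1) * \<theta> = (real r + 2) * \<theta> - \<theta>"
      by (simp_all add: algebra_simps)
    then show ?thesis by (simp add: sin_add sin_diff)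
  qed
  have r: "real (Suc r) + 1 = real r + 2" "real (Suc r) + 2 = real r + 3" by auto
  show ?case
    unfolding r
    by (rule exI[of _ q'], rule exI[of _ "[:0, 2:] * q' - q"])
      (simp add: q s diff_divide_distrib)
qed

lemma chebyshev_U_trig:
  assumes "sin \<theta> \<noteq> 0"
  shows "poly (chebyshev_U r) (cos \<theta>) = sin ((real r + 1) * \<theta>) / sin \<theta>"
proof -
  obtain q :: "real poly"
    where q: "\<And>\<theta>. sin \<theta> \<noteq> 0 \<Longrightarrow> poly q (cos \<theta>) = sin ((real r + 1) * \<theta>) / sin \<theta>"
    using chebyshev_U_exists[of r] by blast
  have "\<forall>\<theta>. sin \<theta> \<noteq> 0 \<longrightarrow>
      poly (chebyshev_U r) (cos \<theta>) = sin ((real r + 1) * \<theta>) / sin \<theta>"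
    unfolding chebyshev_U_def
  proof (rule theI[of _ q])
    show "\<forall>\<theta>. sin \<theta> \<noteq> 0 \<longrightarrow> poly q (cos \<theta>) = sin ((real r + 1) * \<theta>) / sin \<theta>"
      using q by simp
  next
    fix q'
    assume "\<forall>\<theta>. sin \<theta> \<noteq> 0 \<longrightarrow> poly q' (cos \<theta>) = sin ((real r + 1) * \<theta>) / sin \<theta>"
    then show "q' = q"
      by (intro chebyshev_U_unique[OF _ q]) simp_all
  qed
  with assms show ?thesis by blast
qed

lemma chebyshev_U_eqI:
  assumes "\<And>\<theta>. sin \<theta> \<noteq> 0 \<Longrightarrow> poly q (cos \<theta>) = sin ((real r + 1) * \<theta>) / sin \<theta>"
  shows "chebyshev_U r = q"
  by (rule chebyshev_U_unique[OF chebyshev_U_trig assms])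

text \<open>Generating functions are formal, so \<open>\<surd>x\<close> is rendered as the indeterminate
  \<^term>\<open>fls_X\<close> of the field of formal Laurent series, and \<open>x\<close> as its square.
  Accordingly \<open>chebyshev_R k\<close> is \<open>U\<^bsub>k-1\<^esub>(1/(2\<surd>x)) / (\<surd>x U\<^bsub>k\<^esub>(1/(2\<surd>x)))\<close> as a
  Laurent series in \<open>\<surd>x\<close>; a power series \<open>F(x)\<close> is expressed in the same variable by
  \<open>in_sqrt F\<close>. The map \<open>in_sqrt\<close> is injective.\<close>

definition chebyshev_U_fls :: "nat \<Rightarrow> real fls \<Rightarrow> real fls" where
  "chebyshev_U_fls r t = poly (map_poly fls_const (chebyshev_U r)) t"

definition chebyshev_R :: "nat \<Rightarrow> real fls" where
  "chebyshev_R k =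
     chebyshev_U_fls (k - 1) (1 / (2 * fls_X)) / (fls_X * chebyshev_U_fls k (1 / (2 * fls_X)))"

definition in_sqrt :: "real fps \<Rightarrow> real fls" where
  "in_sqrt F = fps_to_fls (fps_compose F (fps_X ^ 2))"

end

theory Submission
  imports Defs
begin

text \<open>Complementation and reversal turn 123-avoiding permutations into 321-avoiding ones, which are
  determined by their running maxima, that is, by a Dyck path. In terms of this path, containing
  \<open>w(m,l)\<close> means that for some \<open>i\<close> the first \<open>i\<close> running maxima take at least \<open>m\<close>
  distinct values above \<open>i + l - m\<close>. Splitting the path at its first return to the diagonal shows
  that the generating functions satisfy \<open>F\<^bsub>m,l\<^esub> = 1 / (1 - x F\<^bsub>m,l-1\<^esub>)\<close> for
  \<open>l \<ge> m\<close>. Since complementation and reversal lead to the patterns with \<open>m\<close> and \<open>l\<close>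
  exchanged, \<open>F\<^bsub>m,l\<^esub> = F\<^bsub>l,m\<^esub>\<close>, so \<open>F\<^bsub>m,l\<^esub>\<close> depends only on
  \<open>m + l\<close> and satisfies the recurrence of the Chebyshev quotients \<open>R\<^bsub>k\<^esub>\<close>. For three or
  more layers the pattern contains 123 and only the Catalan recurrence \<open>F = 1 + x F\<^sup>2\<close> is left.
  For one layer, a 123-avoiding permutation is a union of two decreasing sequences.\<close>

subsection \<open>Dyck paths as lists\<close>

text \<open>\<open>M ! i\<close> is the number of up steps before the down step with index
  \<open>i\<close>, counted from 0. The bound \<open>Suc i \<le> M ! i\<close> keeps the path from
  crossing the diagonal; equality means that it returns to the diagonal right after that down
  step.\<close>

definition dyck_paths :: "nat \<Rightarrow> nat list set" where
  "dyck_paths n = {M. length M = n \<and> sorted M \<and> (\<forall>i<n. Suc i \<le> M ! i \<and> M ! i \<le> n)}"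

text \<open>First-return decomposition: an up step, \<open>A\<close> raised by one, the returning
  down step (the middle entry), then \<open>B\<close> shifted past all of this.\<close>

definition join_paths :: "nat list \<Rightarrow> nat list \<Rightarrow> nat list" where
  "join_paths A B = map Suc A @ Suc (length A) # map (\<lambda>x. x + Suc (length A)) B"

lemma finite_dyck_paths: "finite (dyck_paths n)"
proof (rule finite_subset)
  show "dyck_paths n \<subseteq> {M. set M \<subseteq> {..n} \<and> length M = n}"
    by (auto simp: dyck_paths_def in_set_conv_nth)
qed (simp add: finite_lists_length_eq)

lemma dyck_path_le: "M \<in> dyck_paths n \<Longrightarrow> x \<in> set M \<Longrightarrow> x \<le> n"
  by (auto simp: dyck_paths_def in_set_conv_nth)

lemma join_paths_nth:
  "join_paths A B ! i = (if i < length A then Suc (A ! i) else if i = length A then Suc i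
     else B ! (i - Suc (length A)) + Suc (length A))" if "i < Suc (length A + length B)"
  using that by (auto simp: join_paths_def nth_append nth_Cons')

lemma join_paths_in_dyck_paths:
  assumes "A \<in> dyck_paths r" "B \<in> dyck_paths s"
  shows "join_paths A B \<in> dyck_paths (Suc (r + s))"
proof -
  have len: "length A = r" "length B = s"
    using assms by (auto simp: dyck_paths_def)
  have "sorted (join_paths A B)"
    using assms dyck_path_le[OF assms(1)] len
    by (fastforce simp: join_paths_def sorted_append sorted_map dyck_paths_def)
  moreover have "Suc i \<le> join_paths A B ! i \<and> join_paths A B ! i \<le> Suc (r + s)"
    if "i < Suc (r + s)" for i
  proof -
    have "Suc i \<le> A ! i" "A ! i \<le> r" if "i < r"
      using that assms by (auto simp: dyck_paths_def)
    moreover have "i - Suc r < B ! (i - Suc r)" "B ! (i - Suc r) \<le> s" if "r < i"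
      using that \<open>i < Suc (r + s)\<close> assms by (auto simp: dyck_paths_def Suc_le_eq)
    ultimately show ?thesis
      using that by (fastforce simp: join_paths_nth len)
  qed
  ultimately show ?thesis
    by (simp add: dyck_paths_def join_paths_def len)
qed

text \<open>The length of \<open>A\<close> is the first index at which the joined path returns to
  the diagonal, since the entries of \<open>map Suc A\<close> stay strictly above it. Two joins with
  different lengths would differ at the smaller one.\<close>

lemma join_paths_inj:
  assumes "A \<in> dyck_paths r" "B \<in> dyck_paths s" "A' \<in> dyck_paths r'" "B' \<in> dyck_paths s'"
    and eq: "join_paths A B = join_paths A' B'"
  shows "A = A' \<and> B = B'"
proof -
  have not_less: "\<not> length C < length C'"
    if "C \<in> dyck_paths t" "C' \<in> dyck_paths t'" "join_paths C D = join_paths C' D'"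
    for C C' D D' t t'
  proof
    assume less: "length C < length C'"
    have "Suc (length C) \<le> C' ! length C"
      using that(2) less by (auto simp: dyck_paths_def)
    moreover have "join_paths C D ! length C = Suc (length C)"
      by (subst join_paths_nth) auto
    moreover have "join_paths C' D' ! length C = Suc (C' ! length C)"
      using less by (subst join_paths_nth) auto
    ultimately show False using that(3) by simp
  qed
  have "length A = length A'"
    using not_less[OF assms(1,3) eq] not_less[OF assms(3,1) eq[symmetric]] by simp
  with eq show ?thesis
    by (auto simp: join_paths_def inj_map_eq_map inj_def)
qed

text \<open>The part \<open>A\<close> ends at the first return \<open>r\<close>, which exists
  because the last entry is \<open>Suc n\<close>. Before \<open>r\<close> the path is strictly above
  the diagonal (\<open>above\<close>), so lowering these entries by one still gives a path.\<close>

lemma dyck_path_split: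
  assumes "M \<in> dyck_paths (Suc n)"
  obtains r A B where "r \<le> n" "A \<in> dyck_paths r" "B \<in> dyck_paths (n - r)" "M = join_paths A B"
proof -
  have len: "length M = Suc n" and srt: "sorted M"
    and bnd: "\<And>i. i \<le> n \<Longrightarrow> Suc i \<le> M ! i \<and> M ! i \<le> Suc n"
    using assms by (auto simp: dyck_paths_def)
  have mono: "M ! i \<le> M ! j" if "i \<le> j" "j \<le> n" for i j
    using that srt len by (simp add: sorted_iff_nth_mono)
  define r where "r = (LEAST i. M ! i = Suc i)"
  have last: "M ! n = Suc n"
    using bnd[of n] by simp
  then have r: "M ! r = Suc r" "r \<le> n"
    unfolding r_def by (rule LeastI, rule Least_le)
  have above: "Suc (Suc i) \<le> M ! i" if "i < r" for i
    using not_less_Least[of i "\<lambda>i. M ! i = Suc i"] bnd[of i] that r(2)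
    by (fastforce simp: r_def)
  define A where "A = map (\<lambda>i. M ! i - 1) [0..<r]"
  define B where "B = map (\<lambda>i. M ! (Suc r + i) - Suc r) [0..<n - r]"
  have "A \<in> dyck_paths r"
  proof -
    have "Suc i \<le> M ! i - 1 \<and> M ! i - 1 \<le> r" if "i < r" for i
      using above[OF that] mono[of i r] that r by linarith
    moreover have "M ! i - 1 \<le> M ! j - 1" if "i \<le> j" "j < r" for i j
      using mono[of i j] that r by simp
    ultimately show ?thesis
      by (simp add: A_def dyck_paths_def sorted_iff_nth_mono)
  qed
  moreover have "B \<in> dyck_paths (n - r)"
  proof -
    have "Suc i \<le> M ! (Suc r + i) - Suc r \<and> M ! (Suc r + i) - Suc r \<le> n - r" if "i < n - r" for i
      using bnd[of "Suc r + i"] that by (simp; linarith)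
    moreover have "M ! (Suc r + i) - Suc r \<le> M ! (Suc r + j) - Suc r" if "i \<le> j" "j < n - r" for i j
      using mono[of "Suc r + i" "Suc r + j"] that by (simp add: diff_le_mono)
    ultimately show ?thesis
      by (simp add: B_def dyck_paths_def sorted_iff_nth_mono del: add_Suc)
  qed
  moreover have "M = join_paths A B"
  proof (rule nth_equalityI)
    show "length M = length (join_paths A B)"
      using r by (simp add: join_paths_def A_def B_def len)
    fix i assume "i < length M"
    then have i: "i \<le> n" by (simp add: len)
    consider "i < r" | "i = r" | "r < i" by linarith
    then show "M ! i = join_paths A B ! i"
    proof cases
      case 1
      then show ?thesis
        using above[of i] i r by (subst join_paths_nth) (auto simp: A_def B_def)
    next
      case 2
      then show ?thesis
        using r by (subst join_paths_nth) (auto simp: A_def B_def)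
    next
      case 3
      then show ?thesis
        using bnd[of i] i r by (subst join_paths_nth) (auto simp: A_def B_def)
    qed
  qed
  ultimately show thesis
    using that r(2) by blast
qed

text \<open>Separate conditions \<open>P\<close> and \<open>Q\<close> are allowed because the raised
  part of a path satisfying \<open>low\<close> obeys \<open>low\<close> with a smaller parameter,
  while the rest keeps the original one.\<close>

lemma card_dyck_paths_Suc:
  assumes "\<And>r s A B. A \<in> dyck_paths r \<Longrightarrow> B \<in> dyck_paths s \<Longrightarrow>
     Q (join_paths A B) \<longleftrightarrow> P A \<and> Q B"
  shows "card {M \<in> dyck_paths (Suc n). Q M} =
    (\<Sum>r\<le>n. card {M \<in> dyck_paths r. P M} * card {M \<in> dyck_paths (n - r). Q M})"
proof -
  let ?S = "SIGMA r:{..n}. {M \<in> dyck_paths r. P M} \<times> {M \<in> dyck_paths (n - r). Q M}"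
  have "bij_betw (\<lambda>(r, A, B). join_paths A B) ?S {M \<in> dyck_paths (Suc n). Q M}"
    unfolding bij_betw_def
  proof (intro conjI inj_onI)
    fix x y
    assume "x \<in> ?S" "y \<in> ?S" and eq: "(\<lambda>(r, A, B). join_paths A B) x = (\<lambda>(r, A, B). join_paths A B) y"
    then obtain r A B r' A' B' where *: "x = (r, A, B)" "y = (r', A', B')"
      "A \<in> dyck_paths r" "B \<in> dyck_paths (n - r)" "A' \<in> dyck_paths r'" "B' \<in> dyck_paths (n - r')"
      by auto
    then have "A = A' \<and> B = B'"
      using eq by (intro join_paths_inj) auto
    with * show "x = y"
      by (auto simp: dyck_paths_def)
  next
    show "(\<lambda>(r, A, B). join_paths A B) ` ?S = {M \<in> dyck_paths (Suc n). Q M}"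
    proof (intro equalityI subsetI)
      fix M assume "M \<in> (\<lambda>(r, A, B). join_paths A B) ` ?S"
      then obtain r A B where *: "r \<le> n" "A \<in> dyck_paths r" "B \<in> dyck_paths (n - r)"
        "P A" "Q B" "M = join_paths A B" by auto
      with join_paths_in_dyck_paths[OF *(2,3)] assms[OF *(2,3)]
      show "M \<in> {M \<in> dyck_paths (Suc n). Q M}" by simp
    next
      fix M assume M: "M \<in> {M \<in> dyck_paths (Suc n). Q M}"
      then obtain r A B where *: "r \<le> n" "A \<in> dyck_paths r" "B \<in> dyck_paths (n - r)" "M = join_paths A B"
        using dyck_path_split by blast
      with M assms[OF *(2,3)] have "(r, A, B) \<in> ?S" by auto
      with *(4) show "M \<in> (\<lambda>(r, A, B). join_paths A B) ` ?S" by force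
    qed
  qed
  then have "card {M \<in> dyck_paths (Suc n). Q M} = card ?S"
    by (simp add: bij_betw_same_card)
  also have "\<dots> = (\<Sum>r\<le>n. card {M \<in> dyck_paths r. P M} * card {M \<in> dyck_paths (n - r). Q M})"
    by (simp add: finite_dyck_paths card_cartesian_product)
  finally show ?thesis .
qed

section \<open>Generating functions of classes of Dyck paths\<close>

definition path_gf :: "(nat list \<Rightarrow> bool) \<Rightarrow> real fps" where
  "path_gf P = Abs_fps (\<lambda>n. of_nat (card {M \<in> dyck_paths n. P M}))"

text \<open>Splitting at the first return becomes a Cauchy product; the empty path contributes the
  constant term 1.\<close>

lemma path_gf_rec:
  assumes "\<And>r s A B. A \<in> dyck_paths r \<Longrightarrow> B \<in> dyck_paths s \<Longrightarrow>
     Q (join_paths A B) \<longleftrightarrow> P A \<and> Q B"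
    and "Q []"
  shows "path_gf Q = 1 + fps_X * (path_gf P * path_gf Q)"
proof (rule fps_ext)
  fix n
  show "fps_nth (path_gf Q) n = fps_nth (1 + fps_X * (path_gf P * path_gf Q)) n"
  proof (cases n)
    case 0
    have "{M \<in> dyck_paths 0. Q M} = {[]}"
      using assms(2) by (auto simp: dyck_paths_def)
    with 0 show ?thesis by (simp add: path_gf_def)
  next
    case (Suc n')
    then show ?thesis
      by (simp add: path_gf_def card_dyck_paths_Suc[OF assms(1)] atLeast0AtMost
          fps_mult_nth[where f = "Abs_fps f" and g = "Abs_fps g" for f g])
  qed
qed

text \<open>For the running maxima \<open>M\<close> of a 321-avoiding permutation, \<open>low m l M\<close> expresses avoidance
  of the pattern \<open>l+1 \<dots> l+m 1 \<dots> l\<close>, the complement of \<open>w(m,l)\<close>. The equation \<open>v + m = i + l\<close>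
  stands for \<open>v = i + l - m\<close>.\<close>

definition low :: "nat \<Rightarrow> nat \<Rightarrow> nat list \<Rightarrow> bool" where
  "low m l M \<longleftrightarrow> (\<forall>i\<le>length M. \<forall>v. v + m = i + l \<longrightarrow> card {x \<in> set (take i M). v < x} < m)"

text \<open>For \<open>i \<le> r\<close> the prefix sees \<open>A\<close> lifted by one, so its
  threshold drops by one, which replaces \<open>Suc l\<close> by \<open>l\<close>. For
  \<open>i > r\<close>, \<open>m \<le> Suc l\<close> forces \<open>Suc r \<le> v\<close>, so no
  entry before \<open>B\<close> counts, and shifting \<open>i\<close> and \<open>v\<close> both by
  \<open>Suc r\<close> preserves \<open>v + m = i + Suc l\<close>.\<close>

lemma low_join_paths:
  assumes m: "1 \<le> m" "m \<le> Suc l" and A: "A \<in> dyck_paths r" and B: "B \<in> dyck_paths s"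
  shows "low m (Suc l) (join_paths A B) \<longleftrightarrow> low m l A \<and> low m (Suc l) B"
proof -
  let ?J = "join_paths A B"
  have len: "length A = r" "length B = s" "length ?J = Suc (r + s)"
    using A B by (auto simp: dyck_paths_def join_paths_def)
  have low: "card {x \<in> set (take i ?J). v < x} = card {x \<in> set (take i A). v - 1 < x}"
    if "i \<le> r" "v + m = i + Suc l" "0 < v" for i v
  proof -
    have "{x \<in> set (take i ?J). v < x} = Suc ` {x \<in> set (take i A). v - 1 < x}"
      using that by (auto simp: join_paths_def take_map len)
    then show ?thesis by (simp add: card_image)
  qed
  have high: "card {x \<in> set (take (Suc r + i) ?J). Suc r + v < x} = card {x \<in> set (take i B). v < x}"
    if "v + m = i + Suc l" for i v
  proof -
    have "x \<le> Suc r + v" if "x \<in> set A" for x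
      using dyck_path_le[OF A that] by simp
    then have "{x \<in> set (take (Suc r + i) ?J). Suc r + v < x} = (\<lambda>x. x + Suc r) ` {x \<in> set (take i B). v < x}"
      using dyck_path_le[OF A] by (fastforce simp: join_paths_def take_map len)
    then show ?thesis by (simp add: card_image inj_on_def)
  qed
  show ?thesis
  proof (intro iffI conjI)
    assume J: "low m (Suc l) ?J"
    show "low m l A"
      unfolding low_def
    proof (intro allI impI)
      fix i v assume "i \<le> length A" "v + m = i + l"
      then have "i \<le> length ?J" "Suc v + m = i + Suc l"
        by (auto simp: len)
      with J have "card {x \<in> set (take i ?J). Suc v < x} < m"
        unfolding low_def by blast
      then show "card {x \<in> set (take i A). v < x} < m"
        using low[of i "Suc v"] \<open>i \<le> length A\<close> \<open>v + m = i + l\<close> by (simp add: len)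
    qed
    show "low m (Suc l) B"
      unfolding low_def
    proof (intro allI impI)
      fix i v assume *: "i \<le> length B" "v + m = i + Suc l"
      then have "Suc r + i \<le> length ?J" "Suc r + v + m = Suc r + i + Suc l"
        by (auto simp: len)
      with J have "card {x \<in> set (take (Suc r + i) ?J). Suc r + v < x} < m"
        unfolding low_def by blast
      with high[OF *(2)] show "card {x \<in> set (take i B). v < x} < m" by simp
    qed
  next
    assume AB: "low m l A \<and> low m (Suc l) B"
    show "low m (Suc l) ?J"
      unfolding low_def
    proof (intro allI impI)
      fix i v assume *: "i \<le> length ?J" "v + m = i + Suc l"
      show "card {x \<in> set (take i ?J). v < x} < m"
      proof (cases "i \<le> r")
        case True
        show ?thesis
        proof (cases v)
          \<comment> \<open>A zero threshold cannot be lowered, but \<open>m \<le> Suc l\<close>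
            lets it occur only for the empty prefix.\<close>
          case 0
          with * m have "i = 0" by simp
          with m show ?thesis by simp
        next
          case (Suc v')
          with * have "card {x \<in> set (take i A). v' < x} < m"
            using AB True by (auto simp: low_def len)
          with low[OF True *(2)] Suc show ?thesis by simp
        qed
      next
        case False
        define i' v' where "i' = i - Suc r" and "v' = v - Suc r"
        have i': "i = Suc r + i'" "v = Suc r + v'" "v' + m = i' + Suc l" "i' \<le> length B"
          using False * m by (auto simp: i'_def v'_def len)
        then have "card {x \<in> set (take i' B). v' < x} < m"
          using AB by (auto simp: low_def)
        with high[OF i'(3)] i' show ?thesis by simp
      qed
    qed
  qed
qed

lemma path_gf_low_rec:
  assumes "1 \<le> m" "m \<le> Suc l"
  shows "path_gf (low m (Suc l)) = 1 + fps_X * (path_gf (low m l) * path_gf (low m (Suc l)))"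
  using assms by (intro path_gf_rec low_join_paths) (auto simp: low_def)

text \<open>Start of the recursion. For \<open>i = 1\<close> the threshold is \<open>v = 0\<close>,
  and the first entry of any nonempty path exceeds it.\<close>

lemma path_gf_low_1_0: "path_gf (low 1 0) = 1"
proof (rule fps_ext)
  fix n
  have "{M \<in> dyck_paths n. low 1 0 M} = (if n = 0 then {[]} else {})"
  proof (cases n)
    case 0
    then show ?thesis by (auto simp: dyck_paths_def low_def)
  next
    case (Suc n')
    have "\<not> low 1 0 M" if "M \<in> dyck_paths n" for M
    proof
      assume "low 1 0 M"
      moreover have "1 \<le> length M"
        using that Suc by (simp add: dyck_paths_def)
      ultimately have "card {x \<in> set (take 1 M). 0 < x} < 1"
        unfolding low_def by (metis add.right_neutral add.left_neutral)
      then have "{x \<in> set (take 1 M). 0 < x} = {}"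
        by simp
      moreover have "M ! 0 \<in> {x \<in> set (take 1 M). 0 < x}"
        using that Suc by (cases M) (auto simp: dyck_paths_def)
      ultimately show False by blast
    qed
    with Suc show ?thesis by auto
  qed
  then show "fps_nth (path_gf (low 1 0)) n = fps_nth 1 n"
    by (simp add: path_gf_def)
qed

subsection \<open>Running maxima of 321-avoiding permutations\<close>

definition free321 :: "nat list \<Rightarrow> bool" where
  "free321 s \<longleftrightarrow> (\<forall>a b c. a < b \<longrightarrow> b < c \<longrightarrow> c < length s \<longrightarrow> s ! b < s ! a \<longrightarrow> \<not> s ! c < s ! b)"

definition free123 :: "nat list \<Rightarrow> bool" where
  "free123 s \<longleftrightarrow> (\<forall>a b c. a < b \<longrightarrow> b < c \<longrightarrow> c < length s \<longrightarrow> s ! a < s ! b \<longrightarrow> \<not> s ! b < s ! c)"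

definition running_max :: "nat list \<Rightarrow> nat list" where
  "running_max s = map (\<lambda>i. Max (set (take (Suc i) s))) [0..<length s]"

lemma length_running_max [simp]: "length (running_max s) = length s"
  by (simp add: running_max_def)

lemma running_max_nth: "i < length s \<Longrightarrow> running_max s ! i = Max (set (take (Suc i) s))"
  by (simp add: running_max_def)

lemma set_take_conv_nth: "i \<le> length s \<Longrightarrow> set (take i s) = (\<lambda>j. s ! j) ` {..<i}"
  by (simp flip: nth_image add: atLeast0LessThan)

lemma set_drop_conv_nth: "set (drop i s) = (\<lambda>j. s ! j) ` {i..<length s}"
proof (intro equalityI subsetI)
  fix x assume "x \<in> set (drop i s)"
  then obtain j where "j < length s - i" "s ! (i + j) = x"
    by (auto simp: in_set_conv_nth)
  then show "x \<in> (\<lambda>j. s ! j) ` {i..<length s}"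
    by (intro image_eqI[of _ _ "i + j"]) auto
next
  fix x assume "x \<in> (\<lambda>j. s ! j) ` {i..<length s}"
  then obtain j where "i \<le> j" "j < length s" "x = s ! j" by auto
  then show "x \<in> set (drop i s)"
    by (auto simp: in_set_conv_nth intro!: exI[of _ "j - i"])
qed

lemma nth_le_running_max: "j \<le> i \<Longrightarrow> i < length s \<Longrightarrow> s ! j \<le> running_max s ! i"
  by (auto simp: running_max_nth set_take_conv_nth)

lemma running_max_attained:
  assumes "i < length s"
  obtains j where "j \<le> i" "running_max s ! i = s ! j"
proof -
  have "running_max s ! i \<in> set (take (Suc i) s)"
    using assms by (subst running_max_nth) (auto intro!: Max_in)
  with assms that show thesis
    by (auto simp: set_take_conv_nth less_Suc_eq_le)
qed

lemma permutations_of_set_length: "s \<in> permutations_of_set {1..n} \<Longrightarrow> length s = n"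
  using length_finite_permutations_of_set by fastforce

text \<open>The first \<open>Suc i\<close> entries are distinct and lie between 1 and their maximum,
  which is therefore at least \<open>Suc i\<close>.\<close>

lemma running_max_in_dyck_paths:
  assumes "s \<in> permutations_of_set {1..n}"
  shows "running_max s \<in> dyck_paths n"
proof -
  have len: "length s = n" and set: "set s = {1..n}" and dist: "distinct s"
    using assms permutations_of_set_length permutations_of_setD by blast+
  have "running_max s ! i \<le> running_max s ! j" if "i \<le> j" "j < n" for i j
    using that running_max_attained[of i s] nth_le_running_max[of _ j s] len
    by (metis le_trans le_less_trans)
  moreover have "Suc i \<le> running_max s ! i \<and> running_max s ! i \<le> n" if "i < n" for i
  proof
    have sub: "set (take (Suc i) s) \<subseteq> {1..n}"
      using set set_take_subset by metis
    have "set (take (Suc i) s) \<subseteq> {1..running_max s ! i}"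
      using that len sub by (auto simp: running_max_nth)
    then have "card (set (take (Suc i) s)) \<le> card {1..running_max s ! i}"
      by (intro card_mono) auto
    then show "Suc i \<le> running_max s ! i"
      using that len dist by (simp add: distinct_card)
    show "running_max s ! i \<le> n"
      using running_max_attained[of i s] that len set
      by (metis atLeastAtMost_iff le_less_trans nth_mem)
  qed
  ultimately show ?thesis
    by (simp add: dyck_paths_def sorted_iff_nth_mono len)
qed

section \<open>Recovery of a 321-avoiding permutation from its running maxima\<close>

definition greedy_step :: "nat \<Rightarrow> nat list \<Rightarrow> nat \<Rightarrow> nat" where
  "greedy_step n xs x = (if x \<in> set xs then Min ({1..n} - set xs) else x)"

text \<open>An entry of a 321-avoiding permutation that is not a running maximum has a larger entry to
  its left, hence no smaller one to its right.\<close>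

lemma free321_greedy:
  assumes s: "s \<in> permutations_of_set {1..n}" and "free321 s" and i: "i < n"
  shows "s ! i = greedy_step n (take i s) (running_max s ! i)"
proof -
  have len: "length s = n" and set: "set s = {1..n}" and dist: "distinct s"
    using s permutations_of_set_length permutations_of_setD by blast+
  have notin: "s ! i \<notin> set (take i s)"
    using dist i len by (auto simp: set_take_conv_nth nth_eq_iff_index_eq)
  have Suc: "set (take (Suc i) s) = insert (s ! i) (set (take i s))"
    using i len by (simp add: take_Suc_conv_app_nth)
  show ?thesis
  proof (cases "running_max s ! i \<in> set (take i s)")
    case False
    moreover obtain j where "j \<le> i" "running_max s ! i = s ! j"
      using running_max_attained[of i s] i len by blast
    ultimately have "running_max s ! i = s ! i"
      using i len by (cases "j = i") (auto simp: set_take_conv_nth)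
    with False show ?thesis by (simp add: greedy_step_def)
  next
    case True
    then obtain j where j: "j < i" "running_max s ! i = s ! j"
      using i len by (auto simp: set_take_conv_nth)
    then have less: "s ! i < s ! j"
      using nth_le_running_max[of i i s] i len dist by (auto simp: le_less nth_eq_iff_index_eq)
    have "Min ({1..n} - set (take i s)) = s ! i"
    proof (rule Min_eqI)
      show "s ! i \<in> {1..n} - set (take i s)"
        using notin i len set nth_mem by blast
      fix y assume y: "y \<in> {1..n} - set (take i s)"
      then obtain c where c: "c < n" "s ! c = y"
        using set len by (metis DiffD1 in_set_conv_nth)
      then have "i \<le> c"
        using y i len by (auto simp: set_take_conv_nth not_less[symmetric])
      then show "s ! i \<le> y"
        using \<open>free321 s\<close> j(1) less c len unfolding free321_def
        by (metis le_less not_less)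
    qed simp
    with True show ?thesis by (simp add: greedy_step_def)
  qed
qed

primrec greedy :: "nat \<Rightarrow> nat list \<Rightarrow> nat \<Rightarrow> nat list" where
  "greedy n M 0 = []"
| "greedy n M (Suc i) = greedy n M i @ [greedy_step n (greedy n M i) (M ! i)]"

lemma length_greedy [simp]: "length (greedy n M i) = i"
  by (induction i) auto

lemma take_greedy: "i \<le> j \<Longrightarrow> take i (greedy n M j) = greedy n M i"
  by (induction j) (auto simp: le_Suc_eq)

lemma nth_greedy: "i < j \<Longrightarrow> greedy n M j ! i = greedy_step n (greedy n M i) (M ! i)"
  using take_greedy[of "Suc i" j n M]
  by (metis Suc_leI greedy.simps(2) length_greedy lessI nth_append_length nth_take)

lemma free321_eq_greedy:
  assumes "s \<in> permutations_of_set {1..n}" "free321 s" "i \<le> n"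
  shows "take i s = greedy n (running_max s) i"
  using assms(3)
proof (induction i)
  case (Suc i)
  have "length s = n"
    using assms(1) by (rule permutations_of_set_length)
  with Suc free321_greedy[OF assms(1,2), of i] show ?case
    by (simp add: take_Suc_conv_app_nth)
qed simp

lemma greedy_invariant:
  assumes M: "M \<in> dyck_paths n"
  shows "i \<le> n \<Longrightarrow> distinct (greedy n M i) \<and> set (greedy n M i) \<subseteq> {1..n} \<and>
    (0 < i \<longrightarrow> Max (set (greedy n M i)) = M ! (i - 1))"
proof (induction i)
  case (Suc i)
  let ?g = "greedy n M i" and ?x = "M ! i"
  have IH: "distinct ?g" "set ?g \<subseteq> {1..n}" "0 < i \<Longrightarrow> Max (set ?g) = M ! (i - 1)"
    using Suc by auto
  have x: "Suc i \<le> ?x" "?x \<le> n" and mono: "M ! (i - 1) \<le> ?x"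
    using M Suc.prems by (auto simp: dyck_paths_def sorted_iff_nth_mono)
  have le: "y \<le> ?x" if "y \<in> set ?g" for y
  proof -
    have "0 < i" using that by (cases i) auto
    then show ?thesis using IH(3) mono that by (metis List.finite_set Max_ge le_trans)
  qed
  have card: "card (set ?g) = i"
    using IH(1) by (simp add: distinct_card)
  let ?y = "greedy_step n ?g ?x"
  have y: "?y \<in> {1..n} - set ?g \<and> ?y \<le> ?x \<and> (?x \<notin> set ?g \<longrightarrow> ?y = ?x)"
  proof (cases "?x \<in> set ?g")
    case True
    have "\<not> {1..?x} \<subseteq> set ?g"
    proof
      assume "{1..?x} \<subseteq> set ?g"
      then have "card {1..?x} \<le> card (set ?g)" by (intro card_mono) auto
      with card x show False by simp
    qed
    then obtain z where "1 \<le> z" "z \<le> ?x" "z \<notin> set ?g"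
      by (meson atLeastAtMost_iff subsetI)
    with x have z: "z \<in> {1..n} - set ?g" "z \<le> ?x"
      by auto
    then have "Min ({1..n} - set ?g) \<in> {1..n} - set ?g" "Min ({1..n} - set ?g) \<le> z"
      by (intro Min_in Min_le; auto)+
    with True le_trans[OF _ z(2)] show ?thesis
      by (auto simp: greedy_step_def simp del: Min_le_iff Min_in)
  next
    case False
    with x show ?thesis by (simp add: greedy_step_def)
  qed
  have "Max (insert ?y (set ?g)) = ?x"
    using y le by (intro Max_eqI) auto
  with IH(1,2) y show ?case by simp
qed simp

lemma greedy_running_max:
  assumes M: "M \<in> dyck_paths n"
  shows "greedy n M n \<in> permutations_of_set {1..n}" "running_max (greedy n M n) = M"
    "free321 (greedy n M n)"
proof -
  let ?s = "greedy n M n"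
  have inv: "distinct ?s" "set ?s \<subseteq> {1..n}"
    using greedy_invariant[OF M, of n] by auto
  then have set: "set ?s = {1..n}"
    by (intro card_subset_eq) (auto simp: distinct_card)
  with inv show perm: "?s \<in> permutations_of_set {1..n}"
    by (intro permutations_of_setI) auto
  show rm: "running_max ?s = M"
  proof (rule nth_equalityI)
    show "length (running_max ?s) = length M"
      using M by (simp add: dyck_paths_def)
    fix i assume "i < length (running_max ?s)"
    then show "running_max ?s ! i = M ! i"
      using greedy_invariant[OF M, of "Suc i"] by (simp add: running_max_nth take_greedy del: greedy.simps)
  qed
  show "free321 ?s"
    unfolding free321_def
  proof (intro allI impI notI)
    fix a b c
    assume abc: "a < b" "b < c" "c < length ?s" "?s ! b < ?s ! a" "?s ! c < ?s ! b"
    then have "?s ! b < M ! b"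
      using nth_le_running_max[of a b ?s] rm by simp
    moreover have b: "?s ! b = greedy_step n (take b ?s) (M ! b)"
      using abc by (simp add: nth_greedy take_greedy)
    ultimately have "?s ! b = Min ({1..n} - set (take b ?s))"
      by (auto simp: greedy_step_def split: if_splits)
    moreover have "?s ! c \<in> {1..n} - set (take b ?s)"
    proof -
      have "?s ! c \<in> {1..n}" using abc set nth_mem by blast
      moreover have "?s ! c \<notin> set (take b ?s)"
        using abc inv(1) by (auto simp: set_take_conv_nth nth_eq_iff_index_eq)
      ultimately show ?thesis by simp
    qed
    ultimately have "?s ! b \<le> ?s ! c" by simp
    with abc show False by simp
  qed
qed

lemma bij_betw_running_max:
  "bij_betw running_max {s \<in> permutations_of_set {1..n}. free321 s} (dyck_paths n)"
proof (rule bij_betw_byWitness[where f' = "\<lambda>M. greedy n M n"])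
  show "\<forall>s\<in>{s \<in> permutations_of_set {1..n}. free321 s}. greedy n (running_max s) n = s"
    using free321_eq_greedy[of _ n n] permutations_of_set_length by fastforce
qed (use greedy_running_max running_max_in_dyck_paths in auto)

lemma card_free321:
  assumes "\<And>s. s \<in> permutations_of_set {1..n} \<Longrightarrow> free321 s \<Longrightarrow> P s \<longleftrightarrow> Q (running_max s)"
  shows "card {s \<in> permutations_of_set {1..n}. free321 s \<and> P s} = card {M \<in> dyck_paths n. Q M}"
proof -
  have "bij_betw running_max {s \<in> {s \<in> permutations_of_set {1..n}. free321 s}. P s} {M \<in> dyck_paths n. Q M}"
    using bij_betw_running_max by (rule bij_betw_Collect) (use assms in auto)
  then show ?thesis
    by (simp add: bij_betw_same_card conj_assoc)
qed

text \<open>Both \<open>i\<close> and \<open>v\<close> include the number of prefix entries that are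
  at most \<open>v\<close>. The rest of \<open>i\<close> counts the larger prefix entries, the rest
  of \<open>v\<close> the small entries of the suffix.\<close>

lemma card_take_drop:
  assumes s: "s \<in> permutations_of_set {1..n}" and "i \<le> n" "v \<le> n"
  shows "i + card {x \<in> set (drop i s). x \<le> v} = v + card {x \<in> set (take i s). v < x}"
proof -
  have len: "length s = n" and set: "set s = {1..n}" and dist: "distinct s"
    using s permutations_of_set_length permutations_of_setD by blast+
  let ?T = "set (take i s)" and ?D = "set (drop i s)"
  have disj: "?T \<inter> ?D = {}"
    using dist by (rule set_take_disj_set_drop_if_distinct) simp
  have un: "?T \<union> ?D = {1..n}"
    unfolding set[symmetric] set_append[symmetric] by simp
  have "{1..v} = {x \<in> {1..n}. x \<le> v}"
    using \<open>v \<le> n\<close> by auto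
  also have "\<dots> = {x \<in> ?T. x \<le> v} \<union> {x \<in> ?D. x \<le> v}"
    unfolding un[symmetric] by blast
  finally have "{1..v} = {x \<in> ?T. x \<le> v} \<union> {x \<in> ?D. x \<le> v}" .
  then have "v = card ({x \<in> ?T. x \<le> v} \<union> {x \<in> ?D. x \<le> v})"
    by (metis card_atLeastAtMost diff_Suc_1)
  also have "\<dots> = card {x \<in> ?T. x \<le> v} + card {x \<in> ?D. x \<le> v}"
    using disj by (intro card_Un_disjoint) auto
  finally have v: "v = card {x \<in> ?T. x \<le> v} + card {x \<in> ?D. x \<le> v}" .
  have "i = card ?T"
    using dist \<open>i \<le> n\<close> len by (simp add: distinct_card)
  also have "?T = {x \<in> ?T. x \<le> v} \<union> {x \<in> ?T. v < x}" by auto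
  also have "card \<dots> = card {x \<in> ?T. x \<le> v} + card {x \<in> ?T. v < x}"
    by (intro card_Un_disjoint) auto
  finally show ?thesis using v by linarith
qed

text \<open>A cut at position \<open>i\<close> and value \<open>v\<close> divides the diagram into
  quadrants. No order inside the two quadrants is demanded, because \<open>free123\<close> makes
  them decreasing once both are nonempty.\<close>

definition two_layers :: "nat \<Rightarrow> nat \<Rightarrow> nat list \<Rightarrow> bool" where
  "two_layers m l s \<longleftrightarrow> (\<exists>i v. m \<le> card {x \<in> set (take i s). x \<le> v} \<and> l \<le> card {x \<in> set (drop i s). v < x})"

definition two_layers_compl :: "nat \<Rightarrow> nat \<Rightarrow> nat list \<Rightarrow> bool" where
  "two_layers_compl m l s \<longleftrightarrow>
    (\<exists>i v. m \<le> card {x \<in> set (take i s). v < x} \<and> l \<le> card {x \<in> set (drop i s). x \<le> v})"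

text \<open>A pair \<open>(i, v)\<close> can be moved to the line \<open>v + m = i + l\<close> by decreasing \<open>v\<close> or \<open>i\<close>. There
  the two inequalities are equivalent, and all entries counted by the first one are running maxima
  since a smaller entry follows.\<close>

lemma two_layers_compl_iff_low:
  assumes s: "s \<in> permutations_of_set {1..n}" and free: "free321 s" and pos: "1 \<le> m" "1 \<le> l"
  shows "\<not> two_layers_compl m l s \<longleftrightarrow> low m l (running_max s)"
proof -
  have len: "length s = n" and set: "set s = {1..n}" and dist: "distinct s"
    using s permutations_of_set_length permutations_of_setD by blast+
  define d where "d i v = card {x \<in> set (take i s). v < x}" for i v
  define e where "e i v = card {x \<in> set (drop i s). x \<le> v}" for i v
  define d' where "d' i v = card {x \<in> set (take i (running_max s)). v < x}" for i v
  have eq: "i + e i v = v + d i v" if "i \<le> n" "v \<le> n" for i v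
    using card_take_drop[OF s that] by (simp add: d_def e_def)
  have bounds: "i \<le> n" if "l \<le> e i v" for i v
  proof (rule ccontr)
    assume "\<not> i \<le> n"
    with len have "e i v = 0" by (simp add: e_def)
    with that pos show False by simp
  qed
  have boundsv: "v \<le> n" if "1 \<le> d i v" for i v
  proof (rule ccontr)
    assume "\<not> v \<le> n"
    then have "{x \<in> set (take i s). v < x} = {}"
      using set set_take_subset[of i s] by fastforce
    with that show False unfolding d_def by simp
  qed
  \<comment> \<open>Running maxima of a prefix are entries of that prefix; only the converse bound
    \<open>le_d'\<close> relies on a smaller entry to the right.\<close>
  have d'_le: "d' i v \<le> d i v" if n: "i \<le> n" for i v
    unfolding d'_def d_def
  proof (intro card_mono subsetI)
    fix x assume x: "x \<in> {x \<in> set (take i (running_max s)). v < x}"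
    then obtain j where "j < i" "x = running_max s ! j"
      using n len by (auto simp: set_take_conv_nth)
    moreover then obtain j' where "j' \<le> j" "x = s ! j'"
      using running_max_attained[of j s] n len by auto
    ultimately show "x \<in> {x \<in> set (take i s). v < x}"
      using x n len by (auto simp: set_take_conv_nth intro!: image_eqI[of _ _ j'])
  qed simp
  have le_d': "d i v \<le> d' i v" if e: "1 \<le> e i v" and n: "i \<le> n" for i v
    unfolding d'_def d_def
  proof (intro card_mono subsetI)
    fix x assume x: "x \<in> {x \<in> set (take i s). v < x}"
    then obtain j where j: "j < i" "x = s ! j"
      using n len by (auto simp: set_take_conv_nth)
    have "{x \<in> set (drop i s). x \<le> v} \<noteq> {}"
      using e unfolding e_def by (metis card.empty not_one_le_zero)
    then obtain c where c: "i \<le> c" "c < n" "s ! c \<le> v"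
      by (auto simp: set_drop_conv_nth len)
    obtain j' where j': "j' \<le> j" "running_max s ! j = s ! j'"
      using running_max_attained[of j s] j n len by auto
    have "j' = j"
    proof (rule ccontr)
      assume "j' \<noteq> j"
      then have "s ! j < s ! j'"
        using nth_le_running_max[of j j s] j' j n len dist
        by (auto simp: le_less nth_eq_iff_index_eq)
      moreover have "s ! c < s ! j"
        using c x j by simp
      ultimately show False
        using free \<open>j' \<noteq> j\<close> j' j c len unfolding free321_def by (metis le_less less_le_trans)
    qed
    then show "x \<in> {x \<in> set (take i (running_max s)). v < x}"
      using x j j' n len by (auto simp: set_take_conv_nth intro!: image_eqI[of _ _ j])
  qed simp
  show ?thesis
  proof
    assume not: "\<not> two_layers_compl m l s"
    show "low m l (running_max s)"
      unfolding low_def d'_def[symmetric]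
    proof (intro allI impI)
      fix i v assume iv: "i \<le> length (running_max s)" "v + m = i + l"
      show "d' i v < m"
      proof (rule ccontr)
        assume "\<not> d' i v < m"
        with d'_le[of i v] iv len have "m \<le> d i v" by simp
        moreover from this have "v \<le> n"
          using boundsv[of i v] pos by linarith
        with eq[of i v] iv len \<open>m \<le> d i v\<close> have "l \<le> e i v" by simp
        ultimately show False
          using not unfolding two_layers_compl_def d_def e_def by blast
      qed
    qed
  next
    assume low: "low m l (running_max s)"
    show "\<not> two_layers_compl m l s"
    proof
      assume "two_layers_compl m l s"
      then obtain i v where iv: "m \<le> d i v" "l \<le> e i v"
        unfolding two_layers_compl_def d_def e_def by blast
      have n: "i \<le> n" "v \<le> n"
        using bounds[of i v] boundsv[of i v] iv pos by linarith+
      \<comment> \<open>The bounds \<open>m \<le> i\<close> and \<open>l \<le> v\<close> make the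
        natural-number subtractions defining \<open>v'\<close> and \<open>i'\<close> exact.\<close>
      have i: "m \<le> i"
      proof -
        have "d i v \<le> card (set (take i s))"
          unfolding d_def by (intro card_mono) auto
        also have "\<dots> \<le> i"
          by (rule le_trans[OF card_length]) simp
        finally show ?thesis using iv by simp
      qed
      have v: "l \<le> v"
      proof -
        have "e i v \<le> card {1..v}"
          unfolding e_def using set set_drop_subset[of i s] by (intro card_mono) auto
        then show ?thesis using iv by simp
      qed
      obtain i' v' where iv': "i' \<le> n" "v' \<le> n" "v' + m = i' + l" "m \<le> d i' v'"
      proof (cases "i + l \<le> v + m")
        case True
        define v' where "v' = i + l - m"
        have "v' \<le> v" "v' + m = i + l"
          using True i by (auto simp: v'_def)
        moreover from this have "d i v \<le> d i v'"
          unfolding d_def by (intro card_mono) auto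
        ultimately show thesis
          using that[of i v'] n iv by simp
      next
        case False
        define i' where "i' = v + m - l"
        have i': "i' \<le> i" "v + m = i' + l"
          using False v by (auto simp: i'_def)
        moreover from this have "e i v \<le> e i' v"
          unfolding e_def using set_drop_subset_set_drop[of i' i s] by (intro card_mono) auto
        ultimately show thesis
          using that[of i' v] eq[of i' v] n iv by simp
      qed
      then have "1 \<le> e i' v'"
        using eq[of i' v'] pos by simp
      with le_d'[of i' v'] iv' have "m \<le> d' i' v'" by simp
      with low iv' len show False
        unfolding low_def d'_def[symmetric] by (metis length_running_max not_less)
    qed
  qed
qed

subsection \<open>Occurrences of layered patterns\<close>

lemma avoids_123_iff: "avoids s [1, 2, 3] \<longleftrightarrow> free123 s"
proof
  assume avoids: "avoids s [1, 2, 3]"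
  show "free123 s"
    unfolding free123_def
  proof (intro allI impI notI)
    fix a b c
    assume "a < b" "b < c" "c < length s" "s ! a < s ! b" "s ! b < s ! c"
    then have "is_occurrence [1, 2, 3] s [a, b, c]"
      by (auto simp: is_occurrence_def order_isomorphic_def less_Suc_eq numeral_3_eq_3)
    with avoids show False by (auto simp: avoids_def)
  qed
next
  assume free: "free123 s"
  show "avoids s [1, 2, 3]"
    unfolding avoids_def
  proof
    assume "\<exists>idx. is_occurrence [1, 2, 3] s idx"
    then obtain idx where occ: "is_occurrence [1, 2, 3] s idx" ..
    then have "length idx = 3"
      by (simp add: is_occurrence_def order_isomorphic_def)
    then obtain a b c where idx: "idx = [a, b, c]"
      by (auto simp: numeral_3_eq_3 length_Suc_conv)
    have less: "map (\<lambda>i. s ! i) idx ! a < map (\<lambda>i. s ! i) idx ! b \<longleftrightarrow> [1, 2, 3 :: nat] ! a < [1, 2, 3] ! b"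
      if "a < 3" "b < 3" for a b
      using occ that idx unfolding is_occurrence_def order_isomorphic_def by simp
    have "a < b" "b < c" "c < length s"
      using occ idx by (auto simp: is_occurrence_def)
    moreover have "s ! a < s ! b" "s ! b < s ! c"
      using less[of 0 1] less[of 1 2] idx by simp_all
    ultimately show False
      using free by (auto simp: free123_def)
  qed
qed

lemma sorted_wrt_greater_nth:
  fixes xs :: "nat list"
  assumes "sorted_wrt (>) xs" "a < length xs" "b < length xs"
  shows "xs ! a < xs ! b \<longleftrightarrow> b < a"
  using assms sorted_wrt_nth_less[of "(>)" xs] by (metis linorder_neqE_nat order_less_asym)

lemma order_isomorphic_layer:
  assumes "sorted_wrt (>) xs" "sorted_wrt (>) ys" "length xs = length ys"
  shows "order_isomorphic xs ys"
  using assms by (simp add: order_isomorphic_def sorted_wrt_greater_nth)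

text \<open>How two entries compare depends only on their positions and on the length of the first
  layer, which is the content of \<open>nth\<close>.\<close>

lemma order_isomorphic_two_layers:
  assumes "sorted_wrt (>) xs" "sorted_wrt (>) xs'" "\<forall>x\<in>set xs. \<forall>y\<in>set xs'. x < y"
    and "sorted_wrt (>) ys" "sorted_wrt (>) ys'" "\<forall>x\<in>set ys. \<forall>y\<in>set ys'. x < y"
    and "length xs = length ys" "length xs' = length ys'"
  shows "order_isomorphic (xs @ xs') (ys @ ys')"
proof -
  have nth: "(us @ us') ! a < (us @ us') ! b \<longleftrightarrow>
      (a < length us \<and> length us \<le> b) \<or> (b < a \<and> \<not> (b < length us \<and> length us \<le> a))"
    if "sorted_wrt (>) us" "sorted_wrt (>) us'" "\<forall>x\<in>set us. \<forall>y\<in>set us'. x < y"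
      "a < length us + length us'" "b < length us + length us'"
    for us us' :: "nat list" and a b
  proof -
    consider "a < length us" "b < length us" | "a < length us" "length us \<le> b"
      | "length us \<le> a" "b < length us" | "length us \<le> a" "length us \<le> b" by linarith
    then show ?thesis
    proof cases
      case 1
      with that show ?thesis by (simp add: nth_append sorted_wrt_greater_nth)
    next
      case 2
      with that have "us ! a < us' ! (b - length us)" by simp
      with 2 show ?thesis by (simp add: nth_append)
    next
      case 3
      with that have "us ! b < us' ! (a - length us)" by simp
      with 3 show ?thesis by (simp add: nth_append)
    next
      case 4
      with that show ?thesis by (simp add: nth_append sorted_wrt_greater_nth less_diff_conv)
    qed
  qed
  show ?thesis
    using assms by (simp add: order_isomorphic_def nth)
qed

text \<open>An ascent in the lower left quadrant followed by an entry of the upper right one is a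
  123, and likewise with the ascent in the upper right; so entries picked from the quadrants form
  two decreasing layers. Conversely, an occurrence is cut just before the first position of its
  second layer and at the largest value of its first.\<close>

lemma avoids_two_layers_iff:
  assumes dist: "distinct s" and free: "free123 s"
    and L: "L1 \<noteq> []" "L2 \<noteq> []" "sorted_wrt (>) L1" "sorted_wrt (>) L2" "\<forall>x\<in>set L1. \<forall>y\<in>set L2. x < y"
  shows "avoids s (L1 @ L2) \<longleftrightarrow> \<not> two_layers (length L1) (length L2) s"
proof -
  let ?m = "length L1" and ?l = "length L2"
  have "\<exists>idx. is_occurrence (L1 @ L2) s idx" if two: "two_layers ?m ?l s"
  proof -
    obtain i v where iv: "?m \<le> card {x \<in> set (take i s). x \<le> v}" "?l \<le> card {x \<in> set (drop i s). v < x}"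
      using two unfolding two_layers_def by blast
    have "drop i s \<noteq> []"
      using iv(2) L(2) by auto
    then have i: "i < length s" by simp
    \<comment> \<open>A quadrant may hold more entries than required; \<open>take\<close> keeps
      exactly as many positions as the layer is long.\<close>
    define I where "I = take ?m (filter (\<lambda>j. s ! j \<le> v) [0..<i])"
    define J where "J = take ?l (filter (\<lambda>j. v < s ! j) [i..<length s])"
    have take: "map (\<lambda>j. s ! j) [0..<i] = take i s"
      using i by (subst (2) map_nth[symmetric]) (simp add: take_map)
    have drop: "map (\<lambda>j. s ! j) [i..<length s] = drop i s"
      by (subst (2) map_nth[symmetric]) (simp add: drop_map)
    have "length (filter (\<lambda>j. s ! j \<le> v) [0..<i]) = length (filter (\<lambda>x. x \<le> v) (take i s))"
      by (simp add: filter_map o_def flip: take)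
    also have "\<dots> = card {x \<in> set (take i s). x \<le> v}"
      using dist distinct_card[of "filter (\<lambda>x. x \<le> v) (take i s)"] by simp
    finally have lenI: "length I = ?m" using iv by (simp add: I_def)
    have "length (filter (\<lambda>j. v < s ! j) [i..<length s]) = length (filter (\<lambda>x. v < x) (drop i s))"
      by (simp add: filter_map o_def flip: drop)
    also have "\<dots> = card {x \<in> set (drop i s). v < x}"
      using dist distinct_card[of "filter (\<lambda>x. v < x) (drop i s)"] by simp
    finally have lenJ: "length J = ?l" using iv by (simp add: J_def)
    have setI: "j < i \<and> s ! j \<le> v" if "j \<in> set I" for j
      using that set_take_subset by (fastforce simp: I_def)
    have setJ: "i \<le> j \<and> j < length s \<and> v < s ! j" if "j \<in> set J" for j
      using that set_take_subset by (fastforce simp: J_def)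
    have sortI: "sorted_wrt (<) I" and sortJ: "sorted_wrt (<) J"
      unfolding I_def J_def by (intro sorted_wrt_take sorted_wrt_filter; simp)+
    have decI: "sorted_wrt (\<lambda>a b. s ! b < s ! a) I"
    proof (rule sorted_wrt_mono_rel[OF _ sortI])
      fix a b assume ab: "a \<in> set I" "b \<in> set I" "a < b"
      obtain c where c: "c \<in> set J" using lenJ L(2) by (cases J) auto
      have "s ! b < s ! c" "b < c"
        using setI[OF ab(2)] setJ[OF c] by auto
      then have "\<not> s ! a < s ! b"
        using free ab(3) setJ[OF c] by (auto simp: free123_def)
      moreover have "s ! a \<noteq> s ! b"
        using dist ab(3) setI[OF ab(1)] setI[OF ab(2)] i by (simp add: nth_eq_iff_index_eq)
      ultimately show "s ! b < s ! a" by simp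
    qed
    have decJ: "sorted_wrt (\<lambda>a b. s ! b < s ! a) J"
    proof (rule sorted_wrt_mono_rel[OF _ sortJ])
      fix a b assume ab: "a \<in> set J" "b \<in> set J" "a < b"
      obtain c where c: "c \<in> set I" using lenI L(1) by (cases I) auto
      have "s ! c < s ! a" "c < a"
        using setJ[OF ab(1)] setI[OF c] by auto
      then have "\<not> s ! a < s ! b"
        using free ab(3) setJ[OF ab(2)] by (auto simp: free123_def)
      moreover have "s ! a \<noteq> s ! b"
        using dist ab(3) setJ[OF ab(1)] setJ[OF ab(2)] by (simp add: nth_eq_iff_index_eq)
      ultimately show "s ! b < s ! a" by simp
    qed
    have less: "s ! a < s ! b" if "a \<in> set I" "b \<in> set J" for a b
      using setI[OF that(1)] setJ[OF that(2)] by linarith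
    have "order_isomorphic (map (\<lambda>j. s ! j) I @ map (\<lambda>j. s ! j) J) (L1 @ L2)"
      using decI decJ L lenI lenJ less
      by (intro order_isomorphic_two_layers) (auto simp: sorted_wrt_map)
    moreover have "sorted_wrt (<) (I @ J)"
      using sortI sortJ setI setJ by (fastforce simp: sorted_wrt_append)
    moreover have "set (I @ J) \<subseteq> {..<length s}"
      using setI setJ i by fastforce
    ultimately have "is_occurrence (L1 @ L2) s (I @ J)"
      by (simp add: is_occurrence_def)
    then show ?thesis ..
  qed
  moreover have "two_layers ?m ?l s" if occ: "is_occurrence (L1 @ L2) s idx" for idx
  proof -
    have len: "length idx = ?m + ?l" and sort: "sorted_wrt (<) idx" and sub: "set idx \<subseteq> {..<length s}"
      and iso: "\<And>a b. a < ?m + ?l \<Longrightarrow> b < ?m + ?l \<Longrightarrow>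
        s ! (idx ! a) < s ! (idx ! b) \<longleftrightarrow> (L1 @ L2) ! a < (L1 @ L2) ! b"
      using occ by (auto simp: is_occurrence_def order_isomorphic_def)
    define I where "I = take ?m idx"
    define J where "J = drop ?m idx"
    have IJ: "idx = I @ J" "length I = ?m" "length J = ?l"
      by (simp_all add: I_def J_def len)
    define i where "i = J ! 0"
    define v where "v = Max ((\<lambda>j. s ! j) ` set I)"
    have ne: "I \<noteq> []" "J \<noteq> []"
      using IJ L by auto
    have iJ: "i \<in> set J"
      using ne by (simp add: i_def)
    then have i: "i \<le> length s"
      using sub by (auto simp: IJ(1) intro: less_imp_le)
    have sortIJ: "\<forall>x\<in>set I. \<forall>y\<in>set J. x < y" "sorted_wrt (<) J"
      using sort unfolding IJ(1) sorted_wrt_append by blast+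
    have Ii: "j < i" if "j \<in> set I" for j
      using sortIJ(1) that iJ by blast
    have Ji: "i \<le> j" if "j \<in> set J" for j
      using sortIJ(2) that unfolding i_def by (cases J) (auto intro: less_imp_le)
    have IJless: "s ! a < s ! b" if ab: "a \<in> set I" "b \<in> set J" for a b
    proof -
      obtain a' b' where "a' < ?m" "a = I ! a'" "b' < ?l" "b = J ! b'"
        using ab IJ by (metis in_set_conv_nth)
      with iso[of a' "?m + b'"] show ?thesis
        using L(5) by (simp add: IJ nth_append)
    qed
    have card_map: "card ((\<lambda>j. s ! j) ` set K) = length K" if "set K \<subseteq> set idx" "distinct K" for K
    proof -
      have "inj_on (\<lambda>j. s ! j) (set K)"
        using that(1) sub dist by (intro inj_on_nth) auto
      then show ?thesis
        using that(2) by (simp add: card_image distinct_card)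
    qed
    have "distinct idx"
      using sort by (simp add: strict_sorted_iff)
    then have dIJ: "distinct I" "distinct J" by (simp_all add: IJ)
    have "(\<lambda>j. s ! j) ` set I \<subseteq> {x \<in> set (take i s). x \<le> v}"
      using Ii i by (auto simp: v_def set_take_conv_nth)
    then have "?m \<le> card {x \<in> set (take i s). x \<le> v}"
      using card_mono[OF _ \<open>_ ` set I \<subseteq> _\<close>] card_map[of I] dIJ IJ by simp
    moreover have "v < x" if "x \<in> (\<lambda>j. s ! j) ` set J" for x
      using that IJless ne by (auto simp: v_def)
    then have "(\<lambda>j. s ! j) ` set J \<subseteq> {x \<in> set (drop i s). v < x}"
      using Ji sub IJ by (auto simp: set_drop_conv_nth)
    then have "?l \<le> card {x \<in> set (drop i s). v < x}"
      using card_mono[OF _ \<open>_ ` set J \<subseteq> _\<close>] card_map[of J] dIJ IJ by simp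
    ultimately show ?thesis
      unfolding two_layers_def by blast
  qed
  ultimately show ?thesis
    by (auto simp: avoids_def)
qed

text \<open>One entry from each of the first three layers of \<open>t\<close> forms a 123, so an
  occurrence of \<open>t\<close> would contain an occurrence of 123.\<close>

lemma avoids_three_layers:
  assumes free: "free123 s" and "layered p t" "3 \<le> p"
  shows "avoids s t"
proof -
  obtain Ls where Ls: "length Ls = p" "[] \<notin> set Ls" "t = concat Ls"
    "sorted_wrt (\<lambda>L M. \<forall>x\<in>set L. \<forall>y\<in>set M. x < y) Ls"
    using assms(2) unfolding layered_def by blast
  obtain L1 L2 L3 Ls' where split: "Ls = L1 # L2 # L3 # Ls'"
    using Ls(1) assms(3)
    by (metis Suc_le_length_iff numeral_3_eq_3)
  with Ls obtain x y z where xyz: "x \<in> set L1" "y \<in> set L2" "z \<in> set L3"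
    by (metis last_in_set list.set_intros)
  obtain a b c where abc: "a < length L1" "x = L1 ! a" "b < length L2" "y = L2 ! b" "c < length L3" "z = L3 ! c"
    using xyz by (metis in_set_conv_nth)
  define b' where "b' = length L1 + b"
  define c' where "c' = length L1 + length L2 + c"
  have t: "t = L1 @ L2 @ L3 @ concat Ls'" by (simp add: Ls split)
  have nth: "t ! a = x" "t ! b' = y" "t ! c' = z" "a < b'" "b' < c'" "c' < length t"
    using abc by (auto simp: t b'_def c'_def nth_append)
  have less: "x < y" "y < z"
    using Ls(4) xyz by (auto simp: split)
  show ?thesis
    unfolding avoids_def
  proof
    assume "\<exists>idx. is_occurrence t s idx"
    then obtain idx where occ: "is_occurrence t s idx" ..
    then have len: "length idx = length t" and sort: "sorted_wrt (<) idx" and sub: "set idx \<subseteq> {..<length s}"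
      and iso: "\<And>a b. a < length t \<Longrightarrow> b < length t \<Longrightarrow> s ! (idx ! a) < s ! (idx ! b) \<longleftrightarrow> t ! a < t ! b"
      by (auto simp: is_occurrence_def order_isomorphic_def)
    have "idx ! a < idx ! b'" "idx ! b' < idx ! c'"
      using sort nth len by (auto intro!: sorted_wrt_nth_less[OF sort])
    moreover have "idx ! c' < length s"
      using sub nth(6) len nth_mem[of c' idx] by fastforce
    moreover have "s ! (idx ! a) < s ! (idx ! b')" "s ! (idx ! b') < s ! (idx ! c')"
      using iso[of a b'] iso[of b' c'] nth less by auto
    ultimately show False
      using free unfolding free123_def by blast
  qed
qed

section \<open>Reversal and complement\<close>

lemma free321_rev: "free321 (rev s) \<longleftrightarrow> free123 s"
proof -
  have *: "free321 (rev s)" if "free123 s" for s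
    unfolding free321_def
  proof (intro allI impI notI)
    fix a b c
    assume "a < b" "b < c" "c < length (rev s)" "rev s ! b < rev s ! a" "rev s ! c < rev s ! b"
    moreover from this have "length s - Suc c < length s - Suc b" "length s - Suc b < length s - Suc a"
      "length s - Suc a < length s" by auto
    ultimately show False
      using that by (simp add: free123_def rev_nth)
  qed
  have "free123 (rev s)" if "free321 s" for s
    unfolding free123_def
  proof (intro allI impI notI)
    fix a b c
    assume "a < b" "b < c" "c < length (rev s)" "rev s ! a < rev s ! b" "rev s ! b < rev s ! c"
    moreover from this have "length s - Suc c < length s - Suc b" "length s - Suc b < length s - Suc a"
      "length s - Suc a < length s" by auto
    ultimately show False
      using that by (simp add: free321_def rev_nth)
  qed
  with * show ?thesis by (metis rev_rev_ident)
qed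

text \<open>Reversal exchanges prefix and suffix, so the \<open>l\<close> large entries come first
  and the parameters swap, whereas the complement keeps their order.\<close>

lemma two_layers_compl_rev: "two_layers_compl l m (rev s) \<longleftrightarrow> two_layers m l s"
proof
  assume "two_layers_compl l m (rev s)"
  then show "two_layers m l s"
    unfolding two_layers_compl_def two_layers_def take_rev drop_rev set_rev by blast
next
  assume "two_layers m l s"
  then obtain i v where iv: "m \<le> card {x \<in> set (take i s). x \<le> v}" "l \<le> card {x \<in> set (drop i s). v < x}"
    unfolding two_layers_def by blast
  \<comment> \<open>For \<open>i\<close> beyond the end this is 0, and the prefix and suffix are
    still the whole list and the empty one.\<close>
  define i' where "i' = length s - i"
  have "take (length s - i') s = take i s" "drop (length s - i') s = drop i s"
    by (cases "i \<le> length s"; simp add: i'_def)+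
  with iv show "two_layers_compl l m (rev s)"
    unfolding two_layers_compl_def take_rev drop_rev set_rev by metis
qed

definition compl :: "nat \<Rightarrow> nat list \<Rightarrow> nat list" where
  "compl n s = map (\<lambda>x. Suc n - x) s"

lemma compl_permutation:
  assumes "s \<in> permutations_of_set {1..n}"
  shows "compl n s \<in> permutations_of_set {1..n}" "compl n (compl n s) = s"
proof -
  have set: "set s = {1..n}" and dist: "distinct s"
    using assms permutations_of_setD by blast+
  have "x \<in> (\<lambda>x. Suc n - x) ` {1..n}" if "x \<in> {1..n}" for x
    using that by (intro image_eqI[of _ _ "Suc n - x"]) auto
  then have "(\<lambda>x. Suc n - x) ` {1..n} = {1..n}"
    by auto
  moreover have "inj_on (\<lambda>x. Suc n - x) {1..n}"
    by (auto simp: inj_on_def)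
  ultimately show "compl n s \<in> permutations_of_set {1..n}"
    using set dist by (intro permutations_of_setI) (simp_all add: compl_def distinct_map)
  show "compl n (compl n s) = s"
    using set by (auto simp: compl_def intro!: map_idI)
qed

lemma free123_compl:
  assumes "s \<in> permutations_of_set {1..n}"
  shows "free321 (compl n s) \<longleftrightarrow> free123 s"
proof -
  have "s ! a \<in> {1..n}" if "a < length s" for a
    using assms that nth_mem permutations_of_setD(1) by blast
  then have less: "compl n s ! a < compl n s ! b \<longleftrightarrow> s ! b < s ! a" if "a < length s" "b < length s" for a b
    using that by (fastforce simp: compl_def)
  have "length (compl n s) = length s"
    by (simp add: compl_def)
  then show ?thesis
    unfolding free321_def free123_def by (auto simp: less)
qed

lemma two_layers_compl_compl:
  assumes s: "s \<in> permutations_of_set {1..n}" and pos: "1 \<le> m" "1 \<le> l"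
  shows "two_layers_compl m l (compl n s) \<longleftrightarrow> two_layers m l s"
proof -
  have set: "set s = {1..n}"
    using s permutations_of_setD by blast
  have sub: "set (take i s) \<subseteq> {1..n}" "set (drop i s) \<subseteq> {1..n}" for i
    using set set_take_subset set_drop_subset by metis+
  \<comment> \<open>As \<open>Suc n - x\<close> exceeds \<open>n - v\<close> exactly when
    \<open>x \<le> v\<close>, the threshold becomes \<open>n - v\<close> and the strict and weak
    inequalities trade places.\<close>
  have card: "card {x \<in> (\<lambda>x. Suc n - x) ` A. n - v < x} = card {x \<in> A. x \<le> v}"
    "card {x \<in> (\<lambda>x. Suc n - x) ` A. x \<le> n - v} = card {x \<in> A. v < x}"
    if "A \<subseteq> {1..n}" "v \<le> n" for A v
  proof -
    have inj: "inj_on (\<lambda>x. Suc n - x) B" if "B \<subseteq> A" for B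
      using that \<open>A \<subseteq> {1..n}\<close> by (fastforce simp: inj_on_def)
    have "{x \<in> (\<lambda>x. Suc n - x) ` A. n - v < x} = (\<lambda>x. Suc n - x) ` {x \<in> A. x \<le> v}"
      "{x \<in> (\<lambda>x. Suc n - x) ` A. x \<le> n - v} = (\<lambda>x. Suc n - x) ` {x \<in> A. v < x}"
      using that by fastforce+
    then show "card {x \<in> (\<lambda>x. Suc n - x) ` A. n - v < x} = card {x \<in> A. x \<le> v}"
      "card {x \<in> (\<lambda>x. Suc n - x) ` A. x \<le> n - v} = card {x \<in> A. v < x}"
      by (auto intro!: card_image inj)
  qed
  show ?thesis
  proof
    assume "two_layers_compl m l (compl n s)"
    then obtain i v where iv: "m \<le> card {x \<in> (\<lambda>x. Suc n - x) ` set (take i s). v < x}"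
      "l \<le> card {x \<in> (\<lambda>x. Suc n - x) ` set (drop i s). x \<le> v}"
      unfolding two_layers_compl_def compl_def take_map drop_map set_map by blast
    \<comment> \<open>A threshold above \<open>n\<close> leaves no larger entry, against
      \<open>1 \<le> m\<close>. The bound keeps \<open>n - v\<close> from being truncated.\<close>
    have "v \<le> n"
    proof (rule ccontr)
      assume "\<not> v \<le> n"
      then have "{x \<in> (\<lambda>x. Suc n - x) ` set (take i s). v < x} = {}"
        using sub(1)[of i] by fastforce
      with iv(1) pos show False by simp
    qed
    then have v: "v = n - (n - v)" by simp
    have "m \<le> card {x \<in> set (take i s). x \<le> n - v}" "l \<le> card {x \<in> set (drop i s). n - v < x}"
      using iv card(1)[OF sub(1), of "n - v" i] card(2)[OF sub(2), of "n - v" i] v by simp_all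
    then show "two_layers m l s"
      unfolding two_layers_def by blast
  next
    assume "two_layers m l s"
    then obtain i v where iv: "m \<le> card {x \<in> set (take i s). x \<le> v}" "l \<le> card {x \<in> set (drop i s). v < x}"
      unfolding two_layers_def by blast
    have "v \<le> n"
    proof (rule ccontr)
      assume "\<not> v \<le> n"
      then have "{x \<in> set (drop i s). v < x} = {}"
        using sub(2)[of i] by fastforce
      with iv(2) pos show False by simp
    qed
    then have "m \<le> card {x \<in> (\<lambda>x. Suc n - x) ` set (take i s). n - v < x}"
      "l \<le> card {x \<in> (\<lambda>x. Suc n - x) ` set (drop i s). x \<le> n - v}"
      using iv card(1)[OF sub(1)] card(2)[OF sub(2)] by simp_all
    then show "two_layers_compl m l (compl n s)"
      unfolding two_layers_compl_def compl_def take_map drop_map set_map by blast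
  qed
qed

lemma card_free123_rev:
  "card {s \<in> permutations_of_set {1..n}. free123 s \<and> P s} =
   card {s \<in> permutations_of_set {1..n}. free321 s \<and> P (rev s)}"
proof -
  let ?A = "{s \<in> permutations_of_set {1..n}. free123 s \<and> P s}"
  let ?B = "{s \<in> permutations_of_set {1..n}. free321 s \<and> P (rev s)}"
  have perm: "rev s \<in> permutations_of_set {1..n}" if "s \<in> permutations_of_set {1..n}" for s
    using permutations_of_setD[OF that] by (intro permutations_of_setI) simp_all
  have free: "free123 (rev s) \<longleftrightarrow> free321 s" for s
    using free321_rev[of "rev s"] by simp
  have "bij_betw rev ?A ?B"
  proof (rule bij_betw_byWitness[where f' = rev])
    show "rev ` ?A \<subseteq> ?B"
    proof (rule image_subsetI)
      fix s assume "s \<in> ?A"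
      then show "rev s \<in> ?B" using perm[of s] by (simp add: free321_rev)
    qed
    show "rev ` ?B \<subseteq> ?A"
    proof (rule image_subsetI)
      fix s assume "s \<in> ?B"
      then show "rev s \<in> ?A" using perm[of s] by (simp add: free)
    qed
  qed simp_all
  then show ?thesis by (rule bij_betw_same_card)
qed

lemma card_free123_compl:
  "card {s \<in> permutations_of_set {1..n}. free123 s \<and> P s} =
   card {s \<in> permutations_of_set {1..n}. free321 s \<and> P (compl n s)}"
proof -
  let ?A = "{s \<in> permutations_of_set {1..n}. free123 s \<and> P s}"
  let ?B = "{s \<in> permutations_of_set {1..n}. free321 s \<and> P (compl n s)}"
  have free: "free123 (compl n s) \<longleftrightarrow> free321 s" if "s \<in> permutations_of_set {1..n}" for s
    using free123_compl[OF compl_permutation(1)[OF that]] compl_permutation(2)[OF that] by metis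
  have "bij_betw (compl n) ?A ?B"
  proof (rule bij_betw_byWitness[where f' = "compl n"])
    show "compl n ` ?A \<subseteq> ?B"
    proof (rule image_subsetI)
      fix s assume "s \<in> ?A"
      then show "compl n s \<in> ?B"
        using compl_permutation[of s n] free123_compl[of s n] by simp
    qed
    show "compl n ` ?B \<subseteq> ?A"
    proof (rule image_subsetI)
      fix s assume "s \<in> ?B"
      then show "compl n s \<in> ?A"
        using compl_permutation[of s n] free[of s] by simp
    qed
  qed (use compl_permutation(2) in blast)+
  then show ?thesis by (rule bij_betw_same_card)
qed

text \<open>Complement and reversal send the same set of 123-avoiders to paths with \<open>m\<close>
  and \<open>l\<close> in opposite order. Comparing both counts yields
  \<open>path_gf_low_commute\<close>.\<close>

lemma card_two_layers:
  assumes "1 \<le> m" "1 \<le> l"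
  shows "card {s \<in> permutations_of_set {1..n}. free123 s \<and> \<not> two_layers m l s} =
      card {M \<in> dyck_paths n. low m l M}"
    and "card {s \<in> permutations_of_set {1..n}. free123 s \<and> \<not> two_layers m l s} =
      card {M \<in> dyck_paths n. low l m M}"
proof -
  have "two_layers m l (compl n s) \<longleftrightarrow> two_layers_compl m l s" if "s \<in> permutations_of_set {1..n}" for s
    using two_layers_compl_compl[OF compl_permutation(1)[OF that] assms] compl_permutation(2)[OF that] by metis
  then show "card {s \<in> permutations_of_set {1..n}. free123 s \<and> \<not> two_layers m l s} =
      card {M \<in> dyck_paths n. low m l M}"
    using assms by (subst card_free123_compl, intro card_free321) (simp add: two_layers_compl_iff_low)
  have "two_layers m l (rev s) \<longleftrightarrow> two_layers_compl l m s" for s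
    using two_layers_compl_rev[of l m "rev s"] by simp
  then show "card {s \<in> permutations_of_set {1..n}. free123 s \<and> \<not> two_layers m l s} =
      card {M \<in> dyck_paths n. low l m M}"
    using assms by (subst card_free123_rev, intro card_free321) (simp add: two_layers_compl_iff_low)
qed

subsection \<open>Chebyshev polynomials\<close>

lemma chebyshev_U_0: "chebyshev_U 0 = 1"
  by (rule chebyshev_U_eqI) simp

lemma chebyshev_U_1: "chebyshev_U 1 = [:0, 2:]"
  by (rule chebyshev_U_eqI) (simp add: sin_double)

text \<open>With \<open>a = (r + 2) * \<theta>\<close> this is \<open>sin (a + \<theta>) + sin (a -
  \<theta>) = 2 * cos \<theta> * sin a\<close>.\<close>

lemma chebyshev_U_Suc_Suc:
  "chebyshev_U (Suc (Suc r)) = [:0, 2:] * chebyshev_U (Suc r) - chebyshev_U r"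
proof (rule chebyshev_U_eqI)
  fix \<theta> :: real
  assume \<theta>: "sin \<theta> \<noteq> 0"
  have "(real r + 3) * \<theta> = (real r + 2) * \<theta> + \<theta>" "(real r + 1) * \<theta> = (real r + 2) * \<theta> - \<theta>"
    by (simp_all add: algebra_simps)
  then have "sin ((real r + 3) * \<theta>) = 2 * cos \<theta> * sin ((real r + 2) * \<theta>) - sin ((real r + 1) * \<theta>)"
    by (simp add: sin_add sin_diff)
  with \<theta> show "poly ([:0, 2:] * chebyshev_U (Suc r) - chebyshev_U r) (cos \<theta>) =
      sin ((real (Suc (Suc r)) + 1) * \<theta>) / sin \<theta>"
    by (simp add: chebyshev_U_trig diff_divide_distrib add.commute)
qed

lemma map_poly_fls_const_diff: "map_poly fls_const (p - q) = map_poly fls_const p - map_poly fls_const q"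
  by (intro poly_eqI) (simp add: coeff_map_poly fls_minus_const)

lemma map_poly_fls_const_pCons: "map_poly fls_const (pCons a p) = pCons (fls_const a) (map_poly fls_const p)"
  by (intro poly_eqI) (simp add: coeff_map_poly coeff_pCons split: nat.split)

lemma map_poly_fls_const_smult:
  fixes c :: real
  shows "map_poly fls_const (smult c p) = smult (fls_const c) (map_poly fls_const p)"
  by (intro poly_eqI) (simp add: coeff_map_poly fls_const_mult_const)

lemma chebyshev_U_fls_0: "chebyshev_U_fls 0 t = 1"
  by (simp add: chebyshev_U_fls_def chebyshev_U_0 one_pCons map_poly_fls_const_pCons)

lemma chebyshev_U_fls_1: "chebyshev_U_fls 1 t = 2 * t"
proof -
  have "fls_const (2 :: real) = 2"
    by (simp add: fls_const_numeral)
  then show ?thesis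
    unfolding chebyshev_U_fls_def chebyshev_U_1 by (simp add: map_poly_fls_const_pCons)
qed

lemma chebyshev_U_fls_Suc_Suc:
  "chebyshev_U_fls (Suc (Suc r)) t = 2 * t * chebyshev_U_fls (Suc r) t - chebyshev_U_fls r t"
proof -
  have "fls_const (2 :: real) = 2"
    by (simp add: fls_const_numeral)
  then show ?thesis
    by (simp add: chebyshev_U_fls_def chebyshev_U_Suc_Suc map_poly_fls_const_diff
        map_poly_fls_const_pCons map_poly_fls_const_smult mult_ac)
qed

section \<open>Chebyshev quotients as Laurent series in the square root\<close>

lemma fls_X_mult_half_inverse: "fls_X * (2 * (1 / (2 * fls_X))) = (1 :: real fls)"
proof -
  have "2 * fls_X * (1 / (2 * fls_X)) = (1 :: real fls)"
    by (simp only: times_divide_eq_right mult_1_right) (rule divide_self, simp)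
  then show ?thesis by (simp only: mult_ac)
qed

text \<open>This is \<open>F = 1 / (1 - x G)\<close> with the division cleared and
  \<open>fls_X ^ 2\<close> in place of \<open>x\<close>.\<close>

lemma in_sqrt_rec:
  assumes "F = 1 + fps_X * (G * F)"
  shows "in_sqrt F * (1 - fls_X ^ 2 * in_sqrt G) = 1"
proof -
  have 0: "(fps_X ^ 2 :: real fps) $ 0 = 0" by simp
  have "in_sqrt F = in_sqrt (1 + fps_X * (G * F))"
    using assms by simp
  also have "\<dots> = 1 + fls_X ^ 2 * (in_sqrt G * in_sqrt F)"
    by (simp add: in_sqrt_def fps_compose_add_distrib fps_compose_mult_distrib[OF 0]
        fls_times_fps_to_fls fps_to_fls_power)
  finally show ?thesis
    by (simp add: algebra_simps)
qed

lemma in_sqrt_1: "in_sqrt 1 = 1"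
  by (simp add: in_sqrt_def)

text \<open>Write \<open>X\<close> for \<open>fls_X\<close>. The three-term recurrence gives
  \<open>X U_(r+2) = U_(r+1) - X U_r\<close>; inserting \<open>U_r = G X U_(r+1)\<close> turns the
  right side into \<open>U_(r+1) (1 - X^2 G)\<close>, whose second factor is inverse to
  \<open>F\<close> by \<open>in_sqrt_rec\<close>. The second conclusion feeds the next step of the
  induction.\<close>

lemma chebyshev_U_ratio_step:
  assumes rec: "F = 1 + fps_X * (G * F)"
    and G: "in_sqrt G * (fls_X * chebyshev_U_fls (Suc r) (1 / (2 * fls_X))) = chebyshev_U_fls r (1 / (2 * fls_X))"
    and ne: "chebyshev_U_fls (Suc r) (1 / (2 * fls_X)) \<noteq> 0"
  shows "in_sqrt F * (fls_X * chebyshev_U_fls (Suc (Suc r)) (1 / (2 * fls_X))) =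
      chebyshev_U_fls (Suc r) (1 / (2 * fls_X))"
    and "chebyshev_U_fls (Suc (Suc r)) (1 / (2 * fls_X)) \<noteq> 0"
proof -
  let ?U = "\<lambda>r. chebyshev_U_fls r (1 / (2 * fls_X))"
  have "fls_X * ?U (Suc (Suc r)) = fls_X * (2 * (1 / (2 * fls_X))) * ?U (Suc r) - fls_X * ?U r"
    by (simp add: chebyshev_U_fls_Suc_Suc algebra_simps)
  also have "\<dots> = ?U (Suc r) * (1 - fls_X ^ 2 * in_sqrt G)"
    unfolding fls_X_mult_half_inverse G[symmetric] by (simp add: algebra_simps power2_eq_square)
  finally have U: "fls_X * ?U (Suc (Suc r)) = ?U (Suc r) * (1 - fls_X ^ 2 * in_sqrt G)" .
  have "in_sqrt F * (?U (Suc r) * (1 - fls_X ^ 2 * in_sqrt G)) =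
      ?U (Suc r) * (in_sqrt F * (1 - fls_X ^ 2 * in_sqrt G))"
    by (simp only: mult_ac)
  then show *: "in_sqrt F * (fls_X * ?U (Suc (Suc r))) = ?U (Suc r)"
    by (simp only: U in_sqrt_rec[OF rec] mult_1_right)
  show "?U (Suc (Suc r)) \<noteq> 0"
    using * ne by auto
qed

lemma path_gf_low_commute:
  assumes "1 \<le> m" "1 \<le> l"
  shows "path_gf (low m l) = path_gf (low l m)"
  unfolding path_gf_def card_two_layers[OF assms, symmetric] ..

text \<open>For \<open>m > l\<close> the recurrence does not apply directly, but it does after exchanging \<open>m\<close> and \<open>l\<close>.\<close>

lemma in_sqrt_path_gf_low:
  assumes "1 \<le> m" "m \<le> Suc l" "m + l = Suc r"
  shows "in_sqrt (path_gf (low m l)) * (fls_X * chebyshev_U_fls (Suc r) (1 / (2 * fls_X))) =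
      chebyshev_U_fls r (1 / (2 * fls_X)) \<and> chebyshev_U_fls (Suc r) (1 / (2 * fls_X)) \<noteq> 0"
  using assms
proof (induction r arbitrary: m l)
  case 0
  then have "m = 1" "l = 0" by auto
  have "path_gf (low m l) = 1"
    unfolding \<open>m = 1\<close> \<open>l = 0\<close> by (rule path_gf_low_1_0)
  then have "in_sqrt (path_gf (low m l)) * (fls_X * chebyshev_U_fls (Suc 0) (1 / (2 * fls_X))) =
      chebyshev_U_fls 0 (1 / (2 * fls_X))"
    unfolding One_nat_def[symmetric] chebyshev_U_fls_0 chebyshev_U_fls_1 fls_X_mult_half_inverse
    by (simp only: in_sqrt_1 mult_1_left)
  then show ?case
    unfolding chebyshev_U_fls_0 by (metis mult_zero_right zero_neq_one)
next
  case (Suc r)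
  have step: ?case if "path_gf (low m l) = path_gf (low m' (Suc l'))" "1 \<le> m'" "m' \<le> Suc l'"
    "m' + l' = Suc r" for m' l'
    using chebyshev_U_ratio_step[OF path_gf_low_rec[OF that(2,3)]] Suc.IH[OF that(2-4)] that(1) by simp
  show ?case
  proof (cases "m \<le> l")
    case True
    then obtain l' where "l = Suc l'"
      using Suc.prems by (cases l) auto
    with True Suc.prems show ?thesis by (intro step[of m l']) auto
  next
    \<comment> \<open>After the exchange the pair is \<open>(l, Suc l)\<close>, which the recurrence
      reduces to \<open>(l, l)\<close>.\<close>
    case False
    with Suc.prems have "m = Suc l" "1 \<le> l" by auto
    with Suc.prems path_gf_low_commute[of m l] show ?thesis by (intro step[of l l]) auto
  qed
qed

section \<open>Two layers, and three or more layers\<close>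

lemma avoiders_123_eq:
  "avoiders n {[1, 2, 3], t} = {s \<in> permutations_of_set {1..n}. free123 s \<and> avoids s t}"
  by (auto simp: avoiders_def avoids_123_iff[unfolded One_nat_def])

lemma avoiders_gf_two_layers:
  assumes "layered 2 t" "t \<in> permutations_of_set {1..k}"
  shows "in_sqrt (avoiders_gf {[1, 2, 3], t}) = chebyshev_R k"
proof -
  obtain Ls where Ls: "length Ls = 2" "[] \<notin> set Ls" "t = concat Ls" "\<forall>L\<in>set Ls. sorted_wrt (>) L"
     "sorted_wrt (\<lambda>L M. \<forall>x\<in>set L. \<forall>y\<in>set M. x < y) Ls"
    using assms(1) unfolding layered_def by blast
  then obtain L1 L2 where "Ls = [L1, L2]"
    by (auto simp: numeral_2_eq_2 length_Suc_conv)
  with Ls have L: "t = L1 @ L2" "L1 \<noteq> []" "L2 \<noteq> []" "sorted_wrt (>) L1" "sorted_wrt (>) L2"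
    "\<forall>x\<in>set L1. \<forall>y\<in>set L2. x < y" by auto
  define m l where "m = length L1" and "l = length L2"
  have ml: "1 \<le> m" "1 \<le> l" "m + l = k"
    using L permutations_of_set_length[OF assms(2)] by (auto simp: m_def l_def Suc_le_eq)
  have "avoids s t \<longleftrightarrow> \<not> two_layers m l s" if "s \<in> permutations_of_set {1..n}" "free123 s" for s n
    unfolding m_def l_def L(1)
    using permutations_of_setD(2)[OF that(1)] that(2) L(2-) by (rule avoids_two_layers_iff)
  then have av: "avoiders n {[1, 2, 3], t} =
      {s \<in> permutations_of_set {1..n}. free123 s \<and> \<not> two_layers m l s}" for n
    unfolding avoiders_123_eq by blast
  have gf: "avoiders_gf {[1, 2, 3], t} = path_gf (low m l)"
    by (simp only: av avoiders_gf_def path_gf_def card_two_layers(1)[OF ml(1,2)])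
  obtain r where r: "k = Suc r"
    using ml by (cases k) auto
  have "in_sqrt (path_gf (low m l)) * (fls_X * chebyshev_U_fls k (1 / (2 * fls_X))) =
      chebyshev_U_fls (k - 1) (1 / (2 * fls_X)) \<and> chebyshev_U_fls k (1 / (2 * fls_X)) \<noteq> 0"
  proof (cases "m \<le> Suc l")
    case True
    with in_sqrt_path_gf_low[of m l r] ml r show ?thesis by simp
  next
    \<comment> \<open>The symmetry brings the pair into the range of
      \<open>in_sqrt_path_gf_low\<close>.\<close>
    case False
    with in_sqrt_path_gf_low[of l m r] ml r path_gf_low_commute[of m l] show ?thesis by simp
  qed
  then show ?thesis
    unfolding gf by (simp add: chebyshev_R_def nonzero_eq_divide_eq)
qed

text \<open>Completing the square in \<open>F = 1 + x F^2\<close> gives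
  \<open>(1 - 2 x F)^2 = 1 - 4 x\<close>. The constant term of \<open>1 - 2 x F\<close> is 1, which
  singles out the root given by \<open>fps_radical\<close>.\<close>

lemma avoiders_gf_three_layers:
  assumes "layered p t" "3 \<le> p"
  shows "avoiders_gf {[1, 2, 3], t} = (1 - fps_radical root 2 (1 - 4 * fps_X)) / (2 * fps_X)"
proof -
  define F where "F = path_gf (\<lambda>_. True)"
  \<comment> \<open>The conjunct \<open>True\<close> fits the set to the shape of
    \<open>card_free123_rev\<close> and \<open>card_free321\<close>.\<close>
  have av: "avoiders n {[1, 2, 3], t} = {s \<in> permutations_of_set {1..n}. free123 s \<and> True}" for n
    unfolding avoiders_123_eq using avoids_three_layers[OF _ assms] by blast
  have gf: "avoiders_gf {[1, 2, 3], t} = F"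
    by (simp only: av avoiders_gf_def F_def path_gf_def card_free123_rev card_free321[of _ "\<lambda>_. True" "\<lambda>_. True"])
  have rec: "F = 1 + fps_X * (F * F)"
    unfolding F_def by (rule path_gf_rec) auto
  have "(1 - 2 * fps_X * F) ^ 2 = 1 - 4 * fps_X * F + 4 * fps_X * (fps_X * (F * F))"
    by (simp add: power2_eq_square algebra_simps)
  also have "fps_X * (F * F) = F - 1"
    using rec by (simp add: algebra_simps)
  also have "1 - 4 * fps_X * F + 4 * fps_X * (F - 1) = 1 - 4 * fps_X"
    by (simp add: algebra_simps)
  finally have "(1 - 2 * fps_X * F) ^ Suc 1 = 1 - 4 * fps_X"
    by (simp add: numeral_2_eq_2)
  then have "1 - 2 * fps_X * F = fps_radical root (Suc 1) (1 - 4 * fps_X)"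
    by (subst radical_unique[symmetric]) (auto simp: fps_mult_nth_0 mult.assoc)
  then have "1 - fps_radical root 2 (1 - 4 * fps_X) = F * (2 * fps_X)"
    by (simp add: numeral_2_eq_2 algebra_simps)
  then show ?thesis
    unfolding gf by simp
qed

subsection \<open>One layer\<close>

text \<open>Any \<open>length t\<close> positions of \<open>J\<close>, listed in increasing order,
  would be an occurrence of \<open>t\<close>.\<close>

lemma avoids_layer:
  assumes t: "sorted_wrt (>) t" and "avoids s t"
    and J: "J \<subseteq> {..<length s}" and dec: "\<And>a b. a \<in> J \<Longrightarrow> b \<in> J \<Longrightarrow> a < b \<Longrightarrow> s ! b < s ! a"
  shows "card J < length t"
proof (rule ccontr)
  assume "\<not> card J < length t"
  then obtain I where I: "I \<subseteq> J" "card I = length t" "finite I"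
    using obtain_subset_with_card_n by (metis not_less)
  let ?idx = "sorted_list_of_set I"
  have set: "set ?idx = I" and sort: "sorted_wrt (<) ?idx"
    using I(3) by auto
  have "sorted_wrt (\<lambda>a b. s ! b < s ! a) ?idx"
    using I(1) by (intro sorted_wrt_mono_rel[OF _ sort] dec) (auto simp: set)
  then have "order_isomorphic (map (\<lambda>i. s ! i) ?idx) t"
    using I t by (intro order_isomorphic_layer) (auto simp: sorted_wrt_map)
  then have "is_occurrence t s ?idx"
    using sort I(1) J by (auto simp: is_occurrence_def set)
  with \<open>avoids s t\<close> show False by (auto simp: avoids_def)
qed

text \<open>A 123-avoiding permutation is the union of its left-to-right minima and the remaining
  entries, both of which are decreasing.\<close>

lemma length_avoider_layer:
  assumes s: "s \<in> permutations_of_set {1..n}" "free123 s" and t: "sorted_wrt (>) t" and "avoids s t"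
  shows "n \<le> 2 * length t - 2"
proof -
  have len: "length s = n" and dist: "distinct s"
    using s permutations_of_set_length permutations_of_setD by blast+
  define J where "J = {j. j < n \<and> (\<forall>i<j. s ! j < s ! i)}"
  define K where "K = {j. j < n \<and> (\<exists>i<j. s ! i < s ! j)}"
  have "card J < length t"
    using t \<open>avoids s t\<close> by (rule avoids_layer) (auto simp: J_def len)
  moreover have "card K < length t"
    using t \<open>avoids s t\<close>
  proof (rule avoids_layer)
    fix a b assume ab: "a \<in> K" "b \<in> K" "a < b"
    then obtain i where "i < a" "s ! i < s ! a" "b < n"
      by (auto simp: K_def)
    \<comment> \<open>An ascent from \<open>a\<close> to \<open>b\<close> would complete a 123 with
      the smaller entry at \<open>i\<close>.\<close>
    then have "\<not> s ! a < s ! b"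
      using s(2) ab(3) len by (auto simp: free123_def)
    moreover have "s ! a \<noteq> s ! b"
      using dist ab len by (auto simp: nth_eq_iff_index_eq K_def)
    ultimately show "s ! b < s ! a" by simp
  qed (auto simp: K_def len)
  moreover have "{..<n} = J \<union> K"
  proof -
    have "j \<in> J \<union> K" if j: "j < n" for j
    proof (cases "j \<in> J")
      case False
      then obtain i where "i < j" "\<not> s ! j < s ! i"
        using j by (auto simp: J_def)
      moreover then have "s ! i \<noteq> s ! j"
        using dist j len by (simp add: nth_eq_iff_index_eq)
      ultimately show ?thesis
        using j by (auto simp: K_def)
    qed simp
    then show ?thesis by (auto simp: J_def K_def)
  qed
  then have "n \<le> card J + card K"
    using card_Un_le[of J K] by (metis card_lessThan)
  ultimately show ?thesis by linarith
qed

text \<open>Two decreasing runs of length \<open>r\<close>, the second above the first, attain the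
  bound of \<open>length_avoider_layer\<close>. An increasing subsequence takes at most one entry
  from each run, and a decreasing one stays within a single run.\<close>

lemma avoider_layer_exists:
  assumes t: "sorted_wrt (>) t" "length t = Suc r"
  shows "rev [1..<Suc r] @ rev [Suc r..<Suc (2 * r)] \<in> avoiders (2 * r) {[1, 2, 3], t}"
proof -
  let ?L = "rev [1..<Suc r]" and ?M = "rev [Suc r..<Suc (2 * r)]"
  define s where "s = ?L @ ?M"
  have len: "length s = 2 * r"
    by (simp add: s_def del: upt_Suc)
  have nth: "s ! a = (if a < r then r - a else 3 * r - a)" if "a < 2 * r" for a
    using that by (auto simp: s_def nth_append rev_nth simp del: upt_Suc)
  have perm: "s \<in> permutations_of_set {1..2 * r}"
    by (intro permutations_of_setI) (auto simp: s_def)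
  moreover have "free123 s"
    unfolding free123_def by (auto simp: nth len split: if_splits)
  moreover have "avoids s t"
    unfolding avoids_def
  proof
    assume "\<exists>idx. is_occurrence t s idx"
    then obtain idx where occ: "is_occurrence t s idx" ..
    then have sort: "sorted_wrt (<) idx" and sub: "set idx \<subseteq> {..<2 * r}"
      and iso: "order_isomorphic (map (\<lambda>i. s ! i) idx) t"
      by (simp_all add: is_occurrence_def len)
    have len_idx: "length idx = Suc r"
      using iso t(2) by (simp add: order_isomorphic_def)
    have bound: "idx ! a < 2 * r" if "a < Suc r" for a
      using sub nth_mem[of a idx] len_idx that by (metis lessThan_iff subsetD)
    have dec: "s ! (idx ! b) < s ! (idx ! a)" if "a < b" "b < Suc r" for a b
    proof -
      have "\<not> s ! (idx ! a) < s ! (idx ! b)"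
        using iso that len_idx t sorted_wrt_greater_nth[OF t(1), of a b]
        unfolding order_isomorphic_def by (simp add: t(2))
      moreover have "idx ! a < idx ! b" "idx ! b < 2 * r"
        using that len_idx bound by (auto intro!: sorted_wrt_nth_less[OF sort])
      ultimately show ?thesis by (auto simp: nth split: if_splits)
    qed
    \<comment> \<open>Passing from the first run to the second raises the value, so an occurrence of
      \<open>t\<close> cannot meet both.\<close>
    have same: "idx ! a < r \<longleftrightarrow> idx ! b < r" if "a < b" "b < Suc r" for a b
    proof -
      have "idx ! a < idx ! b"
        using sort that len_idx by (intro sorted_wrt_nth_less[OF sort]) auto
      with dec[OF that] bound[of a] bound[of b] that show ?thesis
        by (auto simp: nth split: if_splits)
    qed
    have "card (set idx) = Suc r"
      using sort len_idx by (simp add: distinct_card strict_sorted_iff)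
    moreover have "set idx \<subseteq> {..<r} \<or> set idx \<subseteq> {r..<2 * r}"
    proof (cases "idx ! 0 < r")
      case True
      then have "idx ! b < r" if "b < Suc r" for b
        using same[of 0 b] that by (cases b) auto
      then have "set idx \<subseteq> {..<r}"
        using len_idx by (auto simp: in_set_conv_nth)
      then show ?thesis ..
    next
      case False
      then have "r \<le> idx ! b" if "b < Suc r" for b
        using same[of 0 b] that by (cases b) auto
      then have "set idx \<subseteq> {r..<2 * r}"
        using len_idx bound by (auto simp: in_set_conv_nth)
      then show ?thesis ..
    qed
    then have "card (set idx) \<le> r"
      using card_mono[of "{..<r}" "set idx"] card_mono[of "{r..<2 * r}" "set idx"] by auto
    ultimately show False by simp
  qed
  ultimately show ?thesis
    unfolding avoiders_123_eq s_def by blast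
qed

text \<open>Coefficients above \<open>2 * k - 2\<close> vanish by
  \<open>length_avoider_layer\<close>, and \<open>avoider_layer_exists\<close> with
  \<open>r = k - 1\<close> makes the one at \<open>2 * k - 2\<close> nonzero.\<close>

lemma avoiders_gf_one_layer:
  assumes "layered 1 t" "t \<in> permutations_of_set {1..k}"
  shows "\<exists>q :: real poly. avoiders_gf {[1, 2, 3], t} = fps_of_poly q \<and> degree q = 2 * k - 2"
proof -
  obtain Ls where Ls: "length Ls = 1" "[] \<notin> set Ls" "t = concat Ls" "\<forall>L\<in>set Ls. sorted_wrt (>) L"
    using assms(1) unfolding layered_def by blast
  then have t: "sorted_wrt (>) t" "t \<noteq> []"
    by (auto simp: length_Suc_conv)
  have len: "length t = k"
    using assms(2) by (rule permutations_of_set_length)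
  with t obtain r where r: "k = Suc r" by (cases k) auto
  let ?c = "\<lambda>n. real (card (avoiders n {[1, 2, 3], t}))"
  have zero: "?c n = 0" if "2 * k - 2 < n" for n
  proof -
    have "avoiders n {[1, 2, 3], t} = {}"
      unfolding avoiders_123_eq using length_avoider_layer[OF _ _ t(1)] that len by fastforce
    then show ?thesis by simp
  qed
  have "?c (2 * r) \<noteq> 0"
  proof -
    have "finite (avoiders (2 * r) {[1, 2, 3], t})"
      unfolding avoiders_123_eq by simp
    then show ?thesis
      using avoider_layer_exists[OF t(1), of r] len r by (auto simp: card_eq_0_iff)
  qed
  then have top: "?c (2 * k - 2) \<noteq> 0"
    using r by simp
  define q where "q = Abs_poly ?c"
  \<comment> \<open>\<open>Abs_poly\<close> gives back a coefficient sequence only if it is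
    eventually zero, which \<open>zero\<close> supplies.\<close>
  have coeff: "coeff q n = ?c n" for n
    unfolding q_def using zero by (subst Abs_poly_inverse) (auto simp: MOST_nat)
  have "avoiders_gf {[1, 2, 3], t} = fps_of_poly q"
    by (rule fps_ext) (simp add: avoiders_gf_def coeff)
  moreover have "degree q = 2 * k - 2"
    using zero top by (intro antisym degree_le le_degree) (auto simp: coeff)
  ultimately show ?thesis by blast
qed

theorem theorem1p2:
  fixes k p :: nat and \<tau> :: "nat list"
  assumes "p \<ge> 1" and "k \<ge> p"
    and "\<tau> \<in> permutations_of_set {1..k}"
    and "layered p \<tau>"
  shows "(p = 1 \<longrightarrow>
            (\<exists>q :: real poly. avoiders_gf {[1, 2, 3], \<tau>} = fps_of_poly q \<and> degree q = 2 * k - 2)) \<and>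
         (p = 2 \<longrightarrow> in_sqrt (avoiders_gf {[1, 2, 3], \<tau>}) = chebyshev_R k) \<and>
         (p \<ge> 3 \<longrightarrow> avoiders_gf {[1, 2, 3], \<tau>} =
            (1 - fps_radical root 2 (1 - 4 * fps_X)) / (2 * fps_X))"
  using assms avoiders_gf_one_layer avoiders_gf_two_layers avoiders_gf_three_layers by blast

end
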